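(* Let $D$ be a v-pseudo-adequate virtual link diagram obtained from a pseudo-adequate virtual link diagram $D'$ by replacing one real crossing $p$ with a virtual crossing $vp$. Let $C_A$ (resp. $C_B$) be the component(s) of $D(s_A)$ (resp. $D(s_B)$) passing through $vp$. Suppose that every connecting arc of $D(s_A)$ whose endpoints are both on $C_A$ is admissible, and that every connecting arc of $D(s_B)$ whose endpoints are both on $C_B$ is admissible. Then $$\mathrm{span}\langle D\rangle = 4c(D)+2(\chi(D)-2),$$ where $c(D)$ is the number of real crossings of $D$ and $\chi(D)$ is the Euler characteristic of the Turaev surface $T_D$.
   Context: **Virtual link diagrams.** Virtual link diagrams are in the sense of Kauffman (generic immersed closed curves in the plane with real crossings and virtual crossings). $c(D)$ is the number of real crossings of $D$. **Splices and connecting arcs.** At a real crossing whose over-strand runs from bottom-left to top-right and whose under-strand runs from top-left to bottom-right, the A-splice replaces the crossing by two vertical strands $)\,($ (one joining the two left endpoints, the other the two right endpoints), and the B-splice replaces it by two horizontal strands (one joining the two top endpoints, the other the two bottom endpoints). At each spliced crossing one draws a short dotted arc, the connecting arc, joining the two new strands. **States and bracket.** A state $s$ of $D$ is a map from the set of real crossings of $D$ to $\{\mathrm{A},\mathrm{B}\}$; $\mathcal{S}$ is the set of states. $D(s)$ is the diagram obtained from $D$ by performing the $s(p)$-splice at each real crossing $p$ (virtual crossings are kept), and $\sharp D(s)$ is its number of components (closed curves). Put $\alpha(s)=\sharp s^{-1}(\mathrm{A})$, $\beta(s)=\sharp s^{-1}(\mathrm{B})$, $\langle D/s\rangle = A^{\alpha(s)-\beta(s)}(-A^2-A^{-2})^{\sharp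 D(s)-1}\in\mathbb{Z}[A,A^{-1}]$ and $\langle D\rangle=\sum_{s\in\mathcal{S}}\langle D/s\rangle$ (Kauffman bracket). For a Laurent polynomial $f$, $\mathrm{span}(f)$ is the maximal degree of $f$ minus the minimal degree of $f$. **Pseudo-adequacy.** $s_A$ (resp. $s_B$) is the state sending every real crossing to A (resp. B). A diagram $D$ is pseudo-adequate if $\sharp D(s_A)\ge \sharp D(s_A(1))$ for every state $s_A(1)$ that sends exactly one real crossing to B and all others to A, and $\sharp D(s_B)\ge\sharp D(s_B(1))$ for every state $s_B(1)$ that sends exactly one real crossing to A and all others to B. A v-pseudo-adequate diagram is one obtained from a pseudo-adequate diagram by virtualizing one real crossing, i.e. replacing that real crossing with a virtual crossing. **Admissible connecting arcs.** A connecting arc $\gamma$ in $D(s)$ is admissible if either (1) $\gamma$ connects two distinct components of $D(s)$, or (2) both endpoints of $\gamma$ are on a single component of $D(s)$ and, for any orientation of that component, the two strands joined by $\gamma$ are oriented in parallel (e.g. for two vertical strands $)\,($ joined by a horizontal connecting arc, both strands point up or both point down). **Turaev surface $T_D$.** Replace each real crossing of $D$ by a disk and join the disks by bands, one for each arc of $D$ (an edge of $D$ viewed as a 4-valent graph whose vertices are the real crossings; virtual crossings are ignored, the bands simply passing each other), so that the resulting surface $F'(D)$ is orientable and is embedded in the plane along $D$ except near virtual crossings. Near each real crossing the boundary of $F'(D)$ consists of four corner arcs, one in each quadrant; colour red the two opposite corners corresponding to the two strands of the A-splice and blue the two opposite corners corresponding to the two strands of the B-splice. Insert a half twist in each band for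 which this is needed to make the colours extend consistently along the whole boundary. The resulting surface with boundary is $F(D)$; its red boundary components correspond to the components of $D(s_A)$ and its blue ones to those of $D(s_B)$. $T_D$ is the closed (possibly non-orientable, possibly disconnected) surface obtained by attaching a disk along each component of $\partial F(D)$. A component of $D$ having no real crossing contributes a 2-sphere to $T_D$. *)

theory Defs
  imports "HOL-Library.Poly_Mapping" "HOL-Library.Numeral_Type" "HOL-Library.FuncSet"
begin

section \<open>Virtual link diagrams\<close>

text \<open>
  Following Kauffman, a virtual link diagram is a 4-valent plane graph (possibly with additional
  circles without vertices) whose vertices are marked as real crossings, with over/under
  information, or as virtual crossings.  The plane graph is given by its rotation system.

  Each crossing \<open>c\<close> has four half-edges \<open>(c, 0), (c, 1), (c, 2), (c, 3)\<close> in counterclockwise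
  order around \<open>c\<close>; the second component lives in the ring \<open>4\<close> of integers modulo 4.  The two
  strands meeting at \<open>c\<close> are \<open>{(c, 0), (c, 2)}\<close> and \<open>{(c, 1), (c, 3)}\<close>.  If \<open>c\<close> is real, the
  strand \<open>{(c, 0), (c, 2)}\<close> is the under-strand.  \<open>glue D\<close> sends a half-edge to
  the other half of the edge to which it belongs, and \<open>circles D\<close> is the number of
  components of the link diagram that pass through no crossing at all.
\<close>

type_synonym 'c half_edge = "'c \<times> 4"

record 'c virtual_diagram =
  crossings :: "'c set"
  real_crossings :: "'c set"
  glue :: "'c half_edge \<Rightarrow> 'c half_edge"
  circles :: nat

definition half_edges :: "'c virtual_diagram \<Rightarrow> 'c half_edge set" where
  "half_edges D = crossings D \<times> UNIV"

definition real_half_edges :: "'c virtual_diagram \<Rightarrow> 'c half_edge set" where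
  "real_half_edges D = real_crossings D \<times> UNIV"

text \<open>The classes of \<open>X\<close> modulo the equivalence relation generated by \<open>r\<close>.\<close>

definition classes :: "'a set \<Rightarrow> ('a \<times> 'a) set \<Rightarrow> 'a set set" where
  "classes X r = X // (r \<union> r\<inverse>)\<^sup>*"

definition glue_rel :: "'c virtual_diagram \<Rightarrow> ('c half_edge \<times> 'c half_edge) set" where
  "glue_rel D = {(h, glue D h) | h. h \<in> half_edges D}"

definition rotation_rel :: "'c virtual_diagram \<Rightarrow> ('c half_edge \<times> 'c half_edge) set" where
  "rotation_rel D = {((c, k), (c, k + 1)) | c k. c \<in> crossings D}"

definition edges :: "'c virtual_diagram \<Rightarrow> 'c half_edge set set" where
  "edges D = {{h, glue D h} | h. h \<in> half_edges D}"

text \<open>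
  Faces are the orbits of the map that crosses the edge of a half-edge and then turns to the
  counterclockwise neighbour at the other end.
\<close>

definition faces :: "'c virtual_diagram \<Rightarrow> 'c half_edge set set" where
  "faces D = classes (half_edges D)
     {(h, (fst (glue D h), snd (glue D h) + 1)) | h. h \<in> half_edges D}"

definition graph_components :: "'c virtual_diagram \<Rightarrow> 'c half_edge set set" where
  "graph_components D = classes (half_edges D) (glue_rel D \<union> rotation_rel D)"

text \<open>
  Every connected component of a rotation system satisfies \<open>V - E + F \<le> 2\<close>, with equality
  iff it is planar; hence the last condition says that every connected component is planar.
\<close>

definition virtual_link_diagram :: "'c virtual_diagram \<Rightarrow> bool" where
  "virtual_link_diagram D \<longleftrightarrow>
     finite (crossings D) \<and>
     real_crossings D \<subseteq> crossings D \<and>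
     (\<forall>h \<in> half_edges D.
        glue D h \<in> half_edges D \<and> glue D h \<noteq> h \<and> glue D (glue D h) = h) \<and>
     int (card (crossings D)) - int (card (edges D)) + int (card (faces D))
       = 2 * int (card (graph_components D))"

definition virtualize :: "'c virtual_diagram \<Rightarrow> 'c \<Rightarrow> 'c virtual_diagram" where
  "virtualize D p = D\<lparr>real_crossings := real_crossings D - {p}\<rparr>"

section \<open>States and the Kauffman bracket\<close>

datatype splice = ASplice | BSplice

primrec other_splice :: "splice \<Rightarrow> splice" where
  "other_splice ASplice = BSplice"
| "other_splice BSplice = ASplice"

text \<open>
  With the over-strand from bottom-left to top-right, label top-left \<open>0\<close>, bottom-left \<open>1\<close>,
  bottom-right \<open>2\<close>, top-right \<open>3\<close>.  The A-splice joins \<open>0\<close> with \<open>1\<close> and \<open>2\<close> with \<open>3\<close>; the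
  B-splice joins \<open>3\<close> with \<open>0\<close> and \<open>1\<close> with \<open>2\<close>.  \<open>splice_mate x k\<close> is the end joined to \<open>k\<close>.
\<close>

definition splice_mate :: "splice \<Rightarrow> 4 \<Rightarrow> 4" where
  "splice_mate x k =
     (case x of
        ASplice \<Rightarrow> (if k \<in> {0, 2} then k + 1 else k - 1)
      | BSplice \<Rightarrow> (if k \<in> {0, 2} then k - 1 else k + 1))"

type_synonym 'c state = "'c \<Rightarrow> splice"

definition states :: "'c virtual_diagram \<Rightarrow> 'c state set" where
  "states D = real_crossings D \<rightarrow>\<^sub>E UNIV"

definition constant_state :: "'c virtual_diagram \<Rightarrow> splice \<Rightarrow> 'c state" where
  "constant_state D x = (\<lambda>c \<in> real_crossings D. x)"

abbreviation state_A :: "'c virtual_diagram \<Rightarrow> 'c state" where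
  "state_A D \<equiv> constant_state D ASplice"

abbreviation state_B :: "'c virtual_diagram \<Rightarrow> 'c state" where
  "state_B D \<equiv> constant_state D BSplice"

text \<open>
  \<open>through D s h\<close> is the other end of the strand of \<open>D(s)\<close> at the crossing of \<open>h\<close> that ends
  in \<open>h\<close>; virtual crossings are traversed straight.
\<close>

definition through :: "'c virtual_diagram \<Rightarrow> 'c state \<Rightarrow> 'c half_edge \<Rightarrow> 'c half_edge" where
  "through D s h =
     (if fst h \<in> real_crossings D then (fst h, splice_mate (s (fst h)) (snd h))
      else (fst h, snd h + 2))"

text \<open>
  The components of \<open>D(s)\<close> other than the \<open>circles D\<close> crossing-free ones, each given as the set
  of half-edges it runs through.
\<close>

definition state_curves :: "'c virtual_diagram \<Rightarrow> 'c state \<Rightarrow> 'c half_edge set set" where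
  "state_curves D s =
     classes (half_edges D) (glue_rel D \<union> {(h, through D s h) | h. h \<in> half_edges D})"

definition num_curves :: "'c virtual_diagram \<Rightarrow> 'c state \<Rightarrow> nat" where
  "num_curves D s = card (state_curves D s) + circles D"

text \<open>
  \<open>\<int>[A, A\<^sup>-\<^sup>1]\<close> as the group ring of the integers: the coefficient of the monomial \<open>A\<^sup>k\<close> is the
  value at \<open>k\<close>.
\<close>

type_synonym laurent_poly = "int \<Rightarrow>\<^sub>0 int"

definition A_pow :: "int \<Rightarrow> laurent_poly" where
  "A_pow k = Poly_Mapping.single k 1"

definition laurent_span :: "laurent_poly \<Rightarrow> int" where
  "laurent_span f = Max (Poly_Mapping.keys f) - Min (Poly_Mapping.keys f)"

definition num_splices :: "'c virtual_diagram \<Rightarrow> 'c state \<Rightarrow> splice \<Rightarrow> nat" where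
  "num_splices D s x = card {c \<in> real_crossings D. s c = x}"

text \<open>The subtraction in the exponent truncates only for the empty diagram.\<close>

definition bracket_state :: "'c virtual_diagram \<Rightarrow> 'c state \<Rightarrow> laurent_poly" where
  "bracket_state D s =
     A_pow (int (num_splices D s ASplice) - int (num_splices D s BSplice))
       * (- A_pow 2 - A_pow (- 2)) ^ (num_curves D s - 1)"

definition bracket :: "'c virtual_diagram \<Rightarrow> laurent_poly" where
  "bracket D = (\<Sum>s \<in> states D. bracket_state D s)"

section \<open>Pseudo-adequacy and admissible connecting arcs\<close>

definition pseudo_adequate :: "'c virtual_diagram \<Rightarrow> bool" where
  "pseudo_adequate D \<longleftrightarrow>
     (\<forall>s \<in> states D. num_splices D s BSplice = 1 \<longrightarrow>
        num_curves D s \<le> num_curves D (state_A D)) \<and>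
     (\<forall>s \<in> states D. num_splices D s ASplice = 1 \<longrightarrow>
        num_curves D s \<le> num_curves D (state_B D))"

definition curves_at :: "'c virtual_diagram \<Rightarrow> 'c state \<Rightarrow> 'c \<Rightarrow> 'c half_edge set set" where
  "curves_at D s c = {C \<in> state_curves D s. \<exists>k. (c, k) \<in> C}"

text \<open>
  An orientation of a component \<open>C\<close> of \<open>D(s)\<close> is given by the set \<open>I\<close> of half-edges along which
  \<open>C\<close> runs into a crossing: every strand at a crossing and every edge has precisely one of its
  two ends in \<open>I\<close>.
\<close>

definition orientation :: "'c virtual_diagram \<Rightarrow> 'c state \<Rightarrow> 'c half_edge set \<Rightarrow> 'c half_edge set \<Rightarrow> bool" where
  "orientation D s C I \<longleftrightarrow>
     I \<subseteq> C \<and>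
     (\<forall>h \<in> C. (through D s h \<in> I \<longleftrightarrow> h \<notin> I) \<and> (glue D h \<in> I \<longleftrightarrow> h \<notin> I))"

text \<open>
  The two strands at a spliced crossing \<open>q\<close> are parallel iff ends on the same side of the
  connecting arc are both incoming or both outgoing.  The two ends on a given side of the
  connecting arc belong to different strands, and are those that the opposite splice would join.
\<close>

definition parallel_strands :: "'c state \<Rightarrow> 'c \<Rightarrow> 'c half_edge set \<Rightarrow> bool" where
  "parallel_strands s q I \<longleftrightarrow>
     (\<forall>k. (q, k) \<in> I \<longleftrightarrow> (q, splice_mate (other_splice (s q)) k) \<in> I)"

text \<open>
  The connecting arc at a real crossing \<open>q\<close> is referred to by \<open>q\<close>.  For either splice, \<open>(q, 0)\<close>
  and \<open>(q, 2)\<close> lie on different strands, so they represent the two endpoints of the arc.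
\<close>

definition admissible :: "'c virtual_diagram \<Rightarrow> 'c state \<Rightarrow> 'c \<Rightarrow> bool" where
  "admissible D s q \<longleftrightarrow>
     (\<exists>C \<in> state_curves D s. \<exists>C' \<in> state_curves D s.
        (q, 0) \<in> C \<and> (q, 2) \<in> C' \<and> C \<noteq> C') \<or>
     (\<exists>C \<in> state_curves D s.
        (q, 0) \<in> C \<and> (q, 2) \<in> C \<and> (\<forall>I. orientation D s C I \<longrightarrow> parallel_strands s q I))"

definition arc_ends_on :: "'c \<Rightarrow> 'c half_edge set \<Rightarrow> bool" where
  "arc_ends_on q X \<longleftrightarrow> (q, 0) \<in> X \<and> (q, 2) \<in> X"

section \<open>The Turaev surface\<close>

text \<open>
  The arcs of \<open>D\<close> are its edges after forgetting the virtual crossings: strings of half-edges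
  running straight through virtual crossings, from one real half-edge to another.
\<close>

definition virtual_rel :: "'c virtual_diagram \<Rightarrow> ('c half_edge \<times> 'c half_edge) set" where
  "virtual_rel D = {((c, k), (c, k + 2)) | c k. c \<in> crossings D - real_crossings D}"

definition arcs :: "'c virtual_diagram \<Rightarrow> 'c half_edge set set" where
  "arcs D = {a \<in> classes (half_edges D) (glue_rel D \<union> virtual_rel D).
     a \<inter> real_half_edges D \<noteq> {}}"

definition joined_by_arc :: "'c virtual_diagram \<Rightarrow> 'c half_edge \<Rightarrow> 'c half_edge \<Rightarrow> bool" where
  "joined_by_arc D h h' \<longleftrightarrow>
     h \<noteq> h' \<and> h \<in> real_half_edges D \<and> h' \<in> real_half_edges D \<and> (\<exists>a \<in> arcs D. h \<in> a \<and> h' \<in> a)"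

text \<open>
  The corner \<open>k\<close> of the disk at a real crossing is the boundary arc between the bands attached at
  \<open>k\<close> and \<open>k + 1\<close>.  It is red if the A-splice joins \<open>k\<close> and \<open>k + 1\<close>, and blue if the B-splice
  does.  The band at \<open>k\<close> therefore has corner \<open>k\<close> on its left and corner \<open>k - 1\<close> on its
  right, looking away from the crossing.  An untwisted band from \<open>(c, k)\<close> to \<open>(c', k')\<close>
  joins left to right, i.e. corner \<open>k\<close> to \<open>k' - 1\<close> and \<open>k - 1\<close> to \<open>k'\<close>.  It is given a half
  twist, so that it joins left to left and right to right, iff the colours disagree otherwise.
\<close>

definition red_corner :: "4 \<Rightarrow> bool" where
  "red_corner k \<longleftrightarrow> splice_mate ASplice k = k + 1"

definition half_twisted :: "'c half_edge \<Rightarrow> 'c half_edge \<Rightarrow> bool" where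
  "half_twisted h h' \<longleftrightarrow> red_corner (snd h) \<noteq> red_corner (snd h' - 1)"

definition corner_rel :: "'c virtual_diagram \<Rightarrow> ('c half_edge \<times> 'c half_edge) set" where
  "corner_rel D =
     {(x, y). \<exists>c k c' k'. joined_by_arc D (c, k) (c', k') \<and>
        (if half_twisted (c, k) (c', k')
         then (x, y) \<in> {((c, k), (c', k')), ((c, k - 1), (c', k' - 1))}
         else (x, y) \<in> {((c, k), (c', k' - 1)), ((c, k - 1), (c', k'))})}"

text \<open>
  The components of the boundary of \<open>F(D)\<close>, as sets of corners; the corner \<open>k\<close> at the crossing
  \<open>c\<close> is represented by the pair \<open>(c, k)\<close>.
\<close>

definition boundary_components :: "'c virtual_diagram \<Rightarrow> 'c half_edge set set" where
  "boundary_components D = classes (real_half_edges D) (corner_rel D)"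

text \<open>Components of \<open>D\<close> itself, again without the \<open>circles D\<close> crossing-free ones.\<close>

definition link_components :: "'c virtual_diagram \<Rightarrow> 'c half_edge set set" where
  "link_components D =
     classes (half_edges D) (glue_rel D \<union> {((c, k), (c, k + 2)) | c k. c \<in> crossings D})"

definition num_components_without_real_crossing :: "'c virtual_diagram \<Rightarrow> nat" where
  "num_components_without_real_crossing D =
     card {C \<in> link_components D. C \<inter> real_half_edges D = {}} + circles D"

text \<open>
  Disks at the real crossings, bands along the arcs, disks glued to the boundary components,
  and a sphere for each component of \<open>D\<close> without real crossing.
\<close>

definition turaev_euler_char :: "'c virtual_diagram \<Rightarrow> int" where
  "turaev_euler_char D =
     int (card (real_crossings D)) - int (card (arcs D)) + int (card (boundary_components D))
       + 2 * int (num_components_without_real_crossing D)"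

end

theory Submission
  imports Defs
begin

text \<open>
  Write \<open>N\<close> for the number of curves of a state and \<open>n\<close> for the number of real crossings.  Flipping
  one splice changes \<open>N\<close> by at most one, and increases it only if the two ends of the connecting arc
  lie on one curve which the flip cuts in two; for an admissible arc this would produce an orientation
  with antiparallel strands.  A connecting arc of \<open>D\<close> with both ends on one curve that avoids \<open>vp\<close> has
  the same curve in \<open>D'\<close>, so the pseudo-adequacy of \<open>D'\<close> together with the admissibility hypothesis
  makes \<open>D\<close> itself pseudo-adequate.  Hence a state with \<open>k > 0\<close> splices B has
  \<open>N \<le> N(s\<^sub>A) + k - 1\<close>, so only \<open>s\<^sub>A\<close> contributes to the degree \<open>n + 2 (N(s\<^sub>A) - 1)\<close>, and dually
  for \<open>s\<^sub>B\<close>.  Finally \<open>\<chi>(D) = N(s\<^sub>A) + N(s\<^sub>B) - n\<close>, since there are \<open>2 n\<close> arcs and the red and blue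
  boundary components are the curves of \<open>s\<^sub>A\<close> and \<open>s\<^sub>B\<close> that meet a real crossing.
\<close>

section \<open>Classes of a generated equivalence relation\<close>

text \<open>The relation whose classes \<open>classes\<close> takes. It is an equivalence on the
  whole type, so classes can be compared without tracking membership in the carrier.\<close>

definition conn :: "('a \<times> 'a) set \<Rightarrow> ('a \<times> 'a) set" where
  "conn r = (r \<union> r\<inverse>)\<^sup>*"

lemma conn_refl [simp]: "(x, x) \<in> conn r"
  by (simp add: conn_def)

lemma conn_sym: "(x, y) \<in> conn r \<Longrightarrow> (y, x) \<in> conn r"
  using sym_rtrancl[of "r \<union> r\<inverse>"] by (auto simp: conn_def sym_def)

lemma conn_trans: "(x, y) \<in> conn r \<Longrightarrow> (y, z) \<in> conn r \<Longrightarrow> (x, z) \<in> conn r"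
  by (simp add: conn_def)

lemma equiv_conn: "equiv UNIV (conn r)"
  by (auto simp: equiv_def refl_on_def sym_def trans_def intro: conn_sym conn_trans)

lemma conn_base: "(x, y) \<in> r \<Longrightarrow> (x, y) \<in> conn r"
  by (auto simp: conn_def)

text \<open>Forward and backward steps are separate cases, so \<open>r\<close> need not be
  symmetric.\<close>

lemma conn_induct [consumes 1, case_names base step backstep]:
  assumes "(x, y) \<in> conn r"
    and "P x"
    and "\<And>y z. (x, y) \<in> conn r \<Longrightarrow> (y, z) \<in> r \<Longrightarrow> P y \<Longrightarrow> P z"
    and "\<And>y z. (x, y) \<in> conn r \<Longrightarrow> (z, y) \<in> r \<Longrightarrow> P y \<Longrightarrow> P z"
  shows "P y"
  using assms(1) unfolding conn_def
proof (induction rule: rtrancl_induct)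
  case (step y z)
  then have "(x, y) \<in> conn r" by (simp add: conn_def)
  then show ?case using step(2,3) assms(3,4) by blast
qed (rule assms(2))

lemma subset_conn: "r \<subseteq> conn r"
  by (simp add: subrelI conn_base)

lemma conn_mono:
  assumes "r \<subseteq> conn r'"
  shows "conn r \<subseteq> conn r'"
proof (rule subrelI)
  fix x y assume "(x, y) \<in> conn r"
  then show "(x, y) \<in> conn r'"
    by (induction rule: conn_induct) (use assms conn_refl conn_trans conn_sym in \<open>metis subsetD\<close>)+
qed

lemma conn_closed:
  assumes "(x, y) \<in> conn r" "x \<in> X" "r \<subseteq> X \<times> X"
  shows "y \<in> X"
  using assms(1) by (induction rule: conn_induct) (use assms(2,3) in blast)+

lemma classes_image: "classes X r = (\<lambda>x. conn r `` {x}) ` X"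
  by (auto simp: classes_def quotient_def conn_def)

lemma finite_classes: "finite X \<Longrightarrow> finite (classes X r)"
  by (simp add: classes_image)

lemma conn_class_eq_iff: "conn r `` {x} = conn r `` {y} \<longleftrightarrow> (x, y) \<in> conn r"
  using eq_equiv_class_iff[OF equiv_conn, of x y r] by simp

lemma class_of_mem: "C \<in> classes X r \<Longrightarrow> x \<in> C \<Longrightarrow> C = conn r `` {x}"
proof -
  assume "C \<in> classes X r" "x \<in> C"
  then obtain y where "C = conn r `` {y}" "(y, x) \<in> conn r" by (auto simp: classes_image)
  then show ?thesis by (simp only: conn_class_eq_iff)
qed

lemma classes_subset:
  assumes "C \<in> classes X r" "r \<subseteq> X \<times> X"
  shows "C \<subseteq> X"
proof
  fix y assume "y \<in> C"
  with assms(1) obtain x where "x \<in> X" "(x, y) \<in> conn r" by (auto simp: classes_image)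
  then show "y \<in> X" using conn_closed assms(2) by metis
qed

lemma conn_image_class:
  assumes "r \<subseteq> conn r'"
  shows "conn r' `` (conn r `` {x}) = conn r' `` {x}"
proof (intro equalityI subsetI)
  fix y assume "y \<in> conn r' `` (conn r `` {x})"
  then obtain z where "(x, z) \<in> conn r" "(z, y) \<in> conn r'" by blast
  then show "y \<in> conn r' `` {x}" using conn_mono[OF assms] conn_trans[of x z r' y] by blast
next
  fix y assume "y \<in> conn r' `` {x}"
  then show "y \<in> conn r' `` (conn r `` {x})" using conn_refl[of x r] by blast
qed

text \<open>Saturating a class under \<open>r'\<close> maps the classes of \<open>r\<close> onto
  those of \<open>r'\<close>; the comparisons of cardinalities between a relation and a coarser one
  rest on this surjection.\<close>

lemma classes_coarser:
  assumes "r \<subseteq> conn r'"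
  shows "classes X r' = (\<lambda>C. conn r' `` C) ` classes X r"
  unfolding classes_image image_image conn_image_class[OF assms] ..

lemma card_classes_coarser:
  assumes "finite X" "r \<subseteq> conn r'"
  shows "card (classes X r') \<le> card (classes X r)"
  unfolding classes_coarser[OF assms(2)] using assms(1)
  by (intro card_image_le finite_classes)

lemma card_classes_eq:
  assumes "finite X" "r \<subseteq> conn r'" "r' \<subseteq> conn r"
  shows "card (classes X r') = card (classes X r)"
  using assms by (intro antisym card_classes_coarser)

text \<open>A path using the new pair several times can be shortened to one that uses it at most
  once.\<close>

lemma conn_insertD:
  assumes "(x, y) \<in> conn (insert (u, v) r)"
  shows "(x, y) \<in> conn r \<or> (x, u) \<in> conn r \<and> (v, y) \<in> conn r
           \<or> (x, v) \<in> conn r \<and> (u, y) \<in> conn r"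
  using assms
proof (induction rule: conn_induct)
  case (step y z)
  have "(y, z) \<in> conn r \<or> y = u \<and> z = v" using step(2) conn_base[of y z r] by blast
  then show ?case using step(3) by (metis conn_trans conn_refl)
next
  case (backstep y z)
  have "(y, z) \<in> conn r \<or> z = u \<and> y = v"
    using backstep(2) conn_sym[OF conn_base, of z y r] by blast
  then show ?case using backstep(3) by (metis conn_trans conn_refl)
qed simp

lemma subset_conn_insert: "r \<subseteq> conn (insert p r)"
  using conn_base[of _ _ "insert p r"] by auto

text \<open>The new pair can only merge the classes of \<open>u\<close> and \<open>v\<close>, so
  saturation is injective once the class of \<open>u\<close> is left out.\<close>

lemma card_classes_insert_le:
  assumes "finite X"
  shows "card (classes X r) \<le> Suc (card (classes X (insert (u, v) r)))"
proof -
  let ?r' = "insert (u, v) r" and ?U = "conn r `` {u}"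
  have "inj_on (\<lambda>C. conn ?r' `` C) (classes X r - {?U})"
  proof (rule inj_onI)
    fix C C' assume C: "C \<in> classes X r - {?U}" "C' \<in> classes X r - {?U}"
      and eq: "conn ?r' `` C = conn ?r' `` C'"
    then obtain x y where xy: "C = conn r `` {x}" "C' = conn r `` {y}"
      by (auto simp: classes_image)
    then have "conn ?r' `` {x} = conn ?r' `` {y}"
      using eq by (simp add: conn_image_class subset_conn_insert)
    then have "(x, y) \<in> conn ?r'"
      by (simp add: conn_class_eq_iff)
    moreover have "(x, u) \<notin> conn r" "(u, y) \<notin> conn r"
      using C xy by (auto simp: conn_class_eq_iff dest: conn_sym)
    ultimately have "(x, y) \<in> conn r"
      using conn_insertD by metis
    then show "C = C'" by (simp add: xy conn_class_eq_iff)
  qed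
  moreover have "(\<lambda>C. conn ?r' `` C) ` (classes X r - {?U}) \<subseteq> classes X ?r'"
    by (subst classes_coarser[OF subset_conn_insert]) blast
  ultimately have "card (classes X r - {?U}) \<le> card (classes X ?r')"
    using finite_classes[OF assms] by (rule card_inj_on_le)
  moreover have "card (classes X r) - 1 \<le> card (classes X r - {?U})"
    using diff_card_le_card_Diff[of "{?U}" "classes X r"] by simp
  ultimately show ?thesis by linarith
qed

text \<open>The classes of \<open>u\<close> and \<open>v\<close> are distinct but have the same
  image, so the surjection of finite sets is not injective.\<close>

lemma card_classes_insert_less:
  assumes "finite X" "u \<in> X" "v \<in> X" "(u, v) \<notin> conn r"
  shows "Suc (card (classes X (insert (u, v) r))) \<le> card (classes X r)"
proof -
  let ?r' = "insert (u, v) r" and ?f = "\<lambda>C. conn (insert (u, v) r) `` C"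
  have "\<not> inj_on ?f (classes X r)"
  proof
    assume inj: "inj_on ?f (classes X r)"
    have "?f (conn r `` {u}) = ?f (conn r `` {v})"
      unfolding conn_image_class[OF subset_conn_insert] conn_class_eq_iff by (simp add: conn_base)
    from inj_onD[OF inj this] have "conn r `` {u} = conn r `` {v}"
      using assms(2,3) by (simp add: classes_image)
    then show False using assms(4) by (simp add: conn_class_eq_iff)
  qed
  then have "card (?f ` classes X r) \<noteq> card (classes X r)"
    using eq_card_imp_inj_on[OF finite_classes[OF assms(1)]] by blast
  then have "card (?f ` classes X r) < card (classes X r)"
    using card_image_le[OF finite_classes[OF assms(1)], of ?f r] by simp
  then show ?thesis
    by (simp add: classes_coarser[OF subset_conn_insert, symmetric])
qed

text \<open>A walk from \<open>x\<close> never leaves the closed set \<open>S\<close>, and inside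
  \<open>S\<close> both relations allow the same steps. This transfers whole curves between diagrams
  or states that differ elsewhere.\<close>

lemma conn_class_local:
  assumes "x \<in> S" "(r \<union> r\<inverse>) `` S \<subseteq> S"
    and "\<And>y z. y \<in> S \<Longrightarrow> (y, z) \<in> r \<union> r\<inverse> \<longleftrightarrow> (y, z) \<in> r' \<union> r'\<inverse>"
  shows "conn r `` {x} = conn r' `` {x}"
proof -
  have "(x, y) \<in> conn r' \<and> y \<in> S" if "(x, y) \<in> conn r" for y
    using that
  proof (induction rule: conn_induct)
    case (step y z)
    then have "z \<in> S" "(y, z) \<in> r' \<union> r'\<inverse>" using assms(2,3) by blast+
    then show ?case using step(3) by (metis UnE converseD conn_trans conn_base conn_sym)
  next
    case (backstep y z)
    then have "z \<in> S" "(y, z) \<in> r' \<union> r'\<inverse>" using assms(2,3) by blast+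
    then show ?case using backstep(3) by (metis UnE converseD conn_trans conn_base conn_sym)
  qed (use assms(1) in auto)
  moreover have "(x, y) \<in> conn r \<and> y \<in> S" if "(x, y) \<in> conn r'" for y
    using that
  proof (induction rule: conn_induct)
    case (step y z)
    then have "z \<in> S" "(y, z) \<in> r \<union> r\<inverse>" using assms(2) assms(3)[of y z] by blast+
    then show ?case using step(3) by (metis UnE converseD conn_trans conn_base conn_sym)
  next
    case (backstep y z)
    then have "z \<in> S" "(y, z) \<in> r \<union> r\<inverse>" using assms(2) assms(3)[of y z] by blast+
    then show ?case using backstep(3) by (metis UnE converseD conn_trans conn_base conn_sym)
  qed (use assms(1) in auto)
  ultimately show ?thesis by blast
qed

lemma class_closed: "(r \<union> r\<inverse>) `` (conn r `` {x}) \<subseteq> conn r `` {x}"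
proof
  fix z assume "z \<in> (r \<union> r\<inverse>) `` (conn r `` {x})"
  then obtain y where "(x, y) \<in> conn r" "(y, z) \<in> r \<union> r\<inverse>" by blast
  then show "z \<in> conn r `` {x}"
    by (metis Image_singleton_iff UnE converseD conn_trans conn_base conn_sym)
qed

text \<open>A class meeting \<open>P\<close> is determined by its trace on \<open>P\<close>, and the
  traces depend only on connectedness between points of \<open>P\<close>. The two carriers may
  therefore differ.\<close>

lemma card_classes_meeting:
  assumes "P \<subseteq> X" "P \<subseteq> Y"
    and "\<And>x y. x \<in> P \<Longrightarrow> y \<in> P \<Longrightarrow> (x, y) \<in> conn r \<longleftrightarrow> (x, y) \<in> conn r'"
  shows "card {C \<in> classes X r. C \<inter> P \<noteq> {}} = card {C \<in> classes Y r'. C \<inter> P \<noteq> {}}"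
proof -
  have *: "card {C \<in> classes X r. C \<inter> P \<noteq> {}} = card ((\<lambda>x. conn r `` {x} \<inter> P) ` P)"
    if "P \<subseteq> X" for X :: "'a set" and r
  proof -
    have eq: "{C \<in> classes X r. C \<inter> P \<noteq> {}} = (\<lambda>x. conn r `` {x}) ` P"
    proof (intro equalityI subsetI)
      fix C assume "C \<in> {C \<in> classes X r. C \<inter> P \<noteq> {}}"
      then obtain x where "C \<in> classes X r" "x \<in> C" "x \<in> P" by blast
      then show "C \<in> (\<lambda>x. conn r `` {x}) ` P" using class_of_mem by fastforce
    next
      fix C assume "C \<in> (\<lambda>x. conn r `` {x}) ` P"
      then obtain x where "x \<in> P" "C = conn r `` {x}" by blast
      then have "C \<in> classes X r" "x \<in> C \<inter> P" using that by (auto simp: classes_image)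
      then show "C \<in> {C \<in> classes X r. C \<inter> P \<noteq> {}}" by blast
    qed
    have "inj_on (\<lambda>C. C \<inter> P) ((\<lambda>x. conn r `` {x}) ` P)"
    proof (rule inj_onI, clarsimp)
      fix x y assume "x \<in> P" "y \<in> P" "conn r `` {x} \<inter> P = conn r `` {y} \<inter> P"
      then have "(x, y) \<in> conn r" by (metis Image_singleton_iff IntD1 IntI conn_refl)
      then show "conn r `` {x} = conn r `` {y}" by (simp add: conn_class_eq_iff)
    qed
    from card_image[OF this] show ?thesis by (simp add: eq image_image)
  qed
  have "(\<lambda>x. conn r `` {x} \<inter> P) ` P = (\<lambda>x. conn r' `` {x} \<inter> P) ` P"
    using assms(3) by (intro image_cong) auto
  then show ?thesis using *[OF assms(1), of r] *[OF assms(2), of r'] by simp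
qed

text \<open>A partial injection has chains and cycles as its components: a step back cancels the
  step taken before it.\<close>

lemma conn_linear:
  assumes "single_valued r" "single_valued (r\<inverse>)" "(x, y) \<in> conn r"
  shows "(x, y) \<in> r\<^sup>* \<or> (y, x) \<in> r\<^sup>*"
  using assms(3)
proof (induction rule: conn_induct)
  case (step y z)
  then show ?case using assms(1)
    by (meson r_into_rtrancl rtrancl.rtrancl_into_rtrancl single_valued_confluent)
next
  case (backstep y z)
  have inj: "w = z" if "(w, y) \<in> r" for w
    using assms(2) that backstep(2) by (auto dest: single_valuedD)
  from backstep(3) show ?case
  proof
    assume "(x, y) \<in> r\<^sup>*"
    then show ?thesis
    proof (cases rule: rtranclE)
      case base
      then show ?thesis using backstep(2) by blast
    qed (use inj in blast)
  next
    assume "(y, x) \<in> r\<^sup>*"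
    with backstep(2) show ?thesis by (meson converse_rtrancl_into_rtrancl)
  qed
qed simp

lemma card_Int_eq_card_Diff:
  assumes "\<And>x. x \<in> S \<Longrightarrow> f x \<in> S" "\<And>x. x \<in> S \<Longrightarrow> f (f x) = x"
    and "\<And>x. x \<in> S \<Longrightarrow> f x \<in> I \<longleftrightarrow> x \<notin> I"
  shows "card (S \<inter> I) = card (S - I)"
  by (rule bij_betw_same_card[of f], rule bij_betw_byWitness[of _ f]) (use assms in auto)

section \<open>Pairs of fixed-point free involutions\<close>

text \<open>In the application \<open>g\<close> is \<open>glue D\<close> and \<open>t\<close> is
  \<open>through D s\<close>, so that the orbits of the pair are the closed curves of a
  state.\<close>

locale involutions =
  fixes X :: "'a set" and g t :: "'a \<Rightarrow> 'a"
  assumes g_mem [simp]: "x \<in> X \<Longrightarrow> g x \<in> X"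
    and g_invol [simp]: "x \<in> X \<Longrightarrow> g (g x) = x"
    and g_neq: "x \<in> X \<Longrightarrow> g x \<noteq> x"
    and t_mem [simp]: "x \<in> X \<Longrightarrow> t x \<in> X"
    and t_invol [simp]: "x \<in> X \<Longrightarrow> t (t x) = x"
    and t_neq: "x \<in> X \<Longrightarrow> t x \<noteq> x"
begin

definition walk_rel :: "('a \<times> 'a) set" where
  "walk_rel = {(x, g x) | x. x \<in> X} \<union> {(x, t x) | x. x \<in> X}"

text \<open>An orientation of all curves at once, given like \<open>orientation\<close> by the
  half-edges running into a crossing.\<close>

definition alternating :: "'a set \<Rightarrow> bool" where
  "alternating I \<longleftrightarrow> (\<forall>x \<in> X. (g x \<in> I \<longleftrightarrow> x \<notin> I) \<and> (t x \<in> I \<longleftrightarrow> x \<notin> I))"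

lemma walk_rel_subset: "walk_rel \<subseteq> X \<times> X"
  by (auto simp: walk_rel_def)

lemma walk_rel_converse: "walk_rel\<inverse> = walk_rel"
  by (auto simp: walk_rel_def)

text \<open>Passing a crossing and then an edge keeps the direction of travel, so the two directions
  of a curve are separate orbits.\<close>

definition double_step :: "('a \<times> 'a) set" where
  "double_step = {(x, g (t x)) | x. x \<in> X}"

lemma double_step_linear:
  assumes "(x, y) \<in> conn double_step"
  shows "(x, y) \<in> double_step\<^sup>* \<or> (y, x) \<in> double_step\<^sup>*"
proof (rule conn_linear[OF _ _ assms])
  show "single_valued double_step" by (auto simp: double_step_def single_valued_def)
  show "single_valued (double_step\<inverse>)"
    by (auto simp: double_step_def single_valued_def) (metis g_invol t_invol t_mem)
qed

text \<open>A relation \<open>(g t)\<^sup>n x = t x\<close> is palindromic, so it would yield a fixed point of its middle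
  letter.\<close>

lemma funpow_neq:
  assumes "x \<in> X"
  shows "((\<lambda>y. g (t y)) ^^ n) x \<noteq> t x"
  using assms
proof (induction n arbitrary: x rule: less_induct)
  case (less n)
  let ?f = "\<lambda>y. g (t y)"
  have mem: "(?f ^^ m) y \<in> X" if "y \<in> X" for m y
    using that by (induction m) auto
  consider "n = 0" | "n = 1" | m where "n = Suc (Suc m)"
    by (metis One_nat_def not0_implies_Suc)
  then show ?case
  proof cases
    case 3
    show ?thesis
    proof
      assume "(?f ^^ n) x = t x"
      then have "?f ((?f ^^ m) (?f x)) = t x"
        using funpow_swap1[of ?f m x] by (simp add: 3)
      \<comment> \<open>Cancelling the outer \<open>g\<close> and \<open>t\<close> leaves the same
        equation with exponent smaller by two and base point \<open>g (t x)\<close>.\<close>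
      then have "(?f ^^ m) (?f x) = t (g (t x))"
        using mem[of "?f x" m] less.prems by (metis g_invol t_invol g_mem t_mem)
      then show False using less.IH[of m "?f x"] 3 less.prems by simp
    qed
  qed (use less.prems t_neq g_neq in \<open>metis funpow_0 t_mem One_nat_def funpow.simps comp_apply id_apply\<close>)+
qed

lemma double_step_funpow:
  "(x, y) \<in> double_step\<^sup>* \<Longrightarrow> \<exists>n. y = ((\<lambda>y. g (t y)) ^^ n) x"
proof (induction rule: rtrancl_induct)
  case base
  show ?case by (rule exI[of _ 0]) simp
next
  case (step y z)
  then obtain n where "y = ((\<lambda>y. g (t y)) ^^ n) x" by blast
  with step(2) show ?case by (intro exI[of _ "Suc n"]) (auto simp: double_step_def)
qed

lemma double_step_neq:
  assumes "x \<in> X"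
  shows "(x, t x) \<notin> conn double_step"
proof
  assume "(x, t x) \<in> conn double_step"
  from double_step_linear[OF this] show False
    using funpow_neq[OF assms] funpow_neq[of "t x"] assms
    by (metis double_step_funpow t_invol t_mem)
qed

lemma double_step_g:
  assumes "x \<in> X"
  shows "(t x, g x) \<in> conn double_step"
  using assms by (intro conn_base) (auto simp: double_step_def intro!: exI[of _ "t x"])

text \<open>Since \<open>t y\<close> and \<open>g y\<close> lie on one double-step orbit, each step
  of a walk exchanges the roles of \<open>y\<close> and \<open>t y\<close>; two orbits thus exhaust
  a curve.\<close>

lemma walk_double_step:
  assumes "(x, y) \<in> conn walk_rel" "x \<in> X"
  shows "y \<in> X \<and> ((x, y) \<in> conn double_step \<or> (x, t y) \<in> conn double_step)"
  using assms(1)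
proof (induction rule: conn_induct)
  case base
  then show ?case using assms(2) by simp
next
  case (step y z)
  have "(t y, g y) \<in> conn double_step" "(t (g y), y) \<in> conn double_step" if "y \<in> X"
    using that double_step_g[of y] double_step_g[of "g y"] by auto
  with step(2,3) show ?case
    by (auto simp: walk_rel_def) (metis conn_trans conn_sym)+
next
  case (backstep y z)
  then have "(y, z) \<in> walk_rel" using walk_rel_converse by blast
  moreover have "(t y, g y) \<in> conn double_step" "(t (g y), y) \<in> conn double_step" if "y \<in> X"
    using that double_step_g[of y] double_step_g[of "g y"] by auto
  ultimately show ?case using backstep(3)
    by (auto simp: walk_rel_def) (metis conn_trans conn_sym)+
qed

text \<open>A curve consists of two double-step orbits, distinct by \<open>double_step_neq\<close>
  and exchanged by both involutions. Choosing one of them on every curve gives an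
  orientation.\<close>

lemma alternating_exists: "\<exists>I \<subseteq> X. alternating I"
proof -
  \<comment> \<open>The choice depends only on the class of \<open>x\<close>, hence is constant
    along each curve.\<close>
  define root where "root x = (SOME y. y \<in> conn walk_rel `` {x})" for x
  have root: "(x, root x) \<in> conn walk_rel" for x
    unfolding root_def using someI[of "\<lambda>y. y \<in> conn walk_rel `` {x}" x] by auto
  have root_eq: "root x = root y" if "(x, y) \<in> conn walk_rel" for x y
    using that unfolding root_def by (metis conn_class_eq_iff)
  define I where "I = {x \<in> X. (root x, x) \<in> conn double_step}"
  have "t x \<in> I \<longleftrightarrow> x \<notin> I" "g x \<in> I \<longleftrightarrow> t x \<in> I" if x: "x \<in> X" for x
  proof -
    have t: "root (t x) = root x" and g: "root (g x) = root x"
      using x by (auto intro!: root_eq[symmetric] conn_base simp: walk_rel_def)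
    have rx: "root x \<in> X" using conn_closed[OF root x walk_rel_subset] .
    have "(root x, x) \<in> conn double_step \<or> (root x, t x) \<in> conn double_step"
      using walk_double_step[OF conn_sym[OF root] rx] by blast
    moreover have "\<not> ((root x, x) \<in> conn double_step \<and> (root x, t x) \<in> conn double_step)"
      using double_step_neq[OF x] by (meson conn_sym conn_trans)
    ultimately show "t x \<in> I \<longleftrightarrow> x \<notin> I" using x t by (auto simp: I_def)
    show "g x \<in> I \<longleftrightarrow> t x \<in> I" using x t g double_step_g[OF x]
      by (auto simp: I_def) (metis conn_trans conn_sym)+
  qed
  then have "alternating I" by (auto simp: alternating_def)
  moreover have "I \<subseteq> X" by (auto simp: I_def)
  ultimately show ?thesis by blast
qed

text \<open>The symmetric difference reverses the orientation of the single curve through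
  \<open>y\<close>.\<close>

lemma alternating_flip:
  assumes "alternating I"
  shows "alternating {x. (x \<in> I) \<noteq> ((y, x) \<in> conn walk_rel)}"
proof -
  have "(y, g x) \<in> conn walk_rel \<longleftrightarrow> (y, x) \<in> conn walk_rel"
    "(y, t x) \<in> conn walk_rel \<longleftrightarrow> (y, x) \<in> conn walk_rel" if "x \<in> X" for x
  proof -
    have "(x, g x) \<in> conn walk_rel" "(x, t x) \<in> conn walk_rel"
      using that by (auto intro!: conn_base simp: walk_rel_def)
    then show "(y, g x) \<in> conn walk_rel \<longleftrightarrow> (y, x) \<in> conn walk_rel"
      "(y, t x) \<in> conn walk_rel \<longleftrightarrow> (y, x) \<in> conn walk_rel"
      by (meson conn_sym conn_trans)+
  qed
  then show ?thesis using assms by (auto simp: alternating_def)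
qed

text \<open>Different curves can be oriented independently: reverse the curve of \<open>x\<close> if
  necessary.\<close>

lemma alternating_separated:
  assumes "x \<in> X" "(x, y) \<notin> conn walk_rel"
  shows "\<exists>I. alternating I \<and> (x \<in> I \<longleftrightarrow> y \<in> I)"
proof -
  obtain I where I: "alternating I" using alternating_exists by blast
  show ?thesis
  proof (cases "x \<in> I \<longleftrightarrow> y \<in> I")
    case False
    then show ?thesis
      using alternating_flip[OF I, of x] assms by (intro exI conjI) auto
  qed (use I in blast)
qed

end

section \<open>Flipping one splice\<close>

lemma exhaust_4: "(k::4) = 0 \<or> k = 1 \<or> k = 2 \<or> k = 3"
proof (induct k)
  case (of_int z)
  then have "z = 0 \<or> z = 1 \<or> z = 2 \<or> z = 3" by simp arith
  then show ?case by auto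
qed

lemma splice_mate_simps [simp]:
  "splice_mate ASplice 0 = 1" "splice_mate ASplice 1 = 0"
  "splice_mate ASplice 2 = 3" "splice_mate ASplice 3 = 2"
  "splice_mate BSplice 0 = 3" "splice_mate BSplice 1 = 2"
  "splice_mate BSplice 2 = 1" "splice_mate BSplice 3 = 0"
  by (simp_all add: splice_mate_def)

lemma splice_mate_invol [simp]: "splice_mate x (splice_mate x k) = k"
  using exhaust_4[of k] by (cases x) auto

lemma splice_mate_neq: "splice_mate x k \<noteq> k"
  using exhaust_4[of k] by (cases x) auto

lemma other_splice_invol [simp]: "other_splice (other_splice x) = x"
  by (cases x) auto

lemma other_splice_neq [simp]: "other_splice x \<noteq> x"
  by (cases x) auto

lemma splice_mate_other:
  "splice_mate (other_splice x) 0 = splice_mate x 2"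
  "splice_mate (other_splice x) 2 = splice_mate x 0"
  by (cases x; simp)+

text \<open>For either splice, \<open>0\<close> and \<open>2\<close> lie on different strands, so
  their mates are the remaining ends. This treats both splices uniformly.\<close>

lemma half_edge_4:
  "k = 0 \<or> k = 2 \<or> k = splice_mate x 0 \<or> k = splice_mate x 2"
  using exhaust_4[of k] by (cases x) auto

definition curve_rel :: "'c virtual_diagram \<Rightarrow> 'c state \<Rightarrow> ('c half_edge \<times> 'c half_edge) set" where
  "curve_rel D s = glue_rel D \<union> {(h, through D s h) | h. h \<in> half_edges D}"

lemma state_curves_eq: "state_curves D s = classes (half_edges D) (curve_rel D s)"
  by (simp add: state_curves_def curve_rel_def)

lemma curve_rel_iff:
  "(y, z) \<in> curve_rel D s \<longleftrightarrow> y \<in> half_edges D \<and> (z = glue D y \<or> z = through D s y)"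
  unfolding curve_rel_def glue_rel_def by blast

abbreviation flip :: "'c state \<Rightarrow> 'c \<Rightarrow> 'c state" where
  "flip s q \<equiv> s(q := other_splice (s q))"

lemma through_flip: "fst h \<noteq> q \<Longrightarrow> through D (flip s q) h = through D s h"
  by (auto simp: through_def)

lemma fst_through [simp]: "fst (through D s h) = fst h"
  by (simp add: through_def)

text \<open>These conditions pass from \<open>D'\<close> to its virtualization, so the results of
  the context serve both diagrams.\<close>

locale link_diagram =
  fixes D :: "'c virtual_diagram"
  assumes finite_crossings: "finite (crossings D)"
    and real_crossings: "real_crossings D \<subseteq> crossings D"
    and glue_mem: "h \<in> half_edges D \<Longrightarrow> glue D h \<in> half_edges D"
    and glue_neq: "h \<in> half_edges D \<Longrightarrow> glue D h \<noteq> h"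
    and glue_glue: "h \<in> half_edges D \<Longrightarrow> glue D (glue D h) = h"
begin

lemma finite_half_edges: "finite (half_edges D)"
  by (simp add: half_edges_def finite_crossings)

lemma finite_real_crossings: "finite (real_crossings D)"
  using finite_crossings real_crossings finite_subset by blast

lemma real_half_edges_subset: "real_half_edges D \<subseteq> half_edges D"
  using real_crossings by (auto simp: half_edges_def real_half_edges_def)

lemma involutions_state: "involutions (half_edges D) (glue D) (through D s)"
proof
  fix h assume "h \<in> half_edges D"
  then show "through D s h \<in> half_edges D" "through D s (through D s h) = h"
    "through D s h \<noteq> h"
    by (auto simp: through_def half_edges_def splice_mate_neq prod_eq_iff)
qed (simp_all add: glue_mem glue_neq glue_glue)

lemma walk_rel_state: "involutions.walk_rel (half_edges D) (glue D) (through D s) = curve_rel D s"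
  by (simp add: involutions.walk_rel_def[OF involutions_state] curve_rel_def glue_rel_def)

lemma curve_rel_subset: "curve_rel D s \<subseteq> half_edges D \<times> half_edges D"
  using involutions.walk_rel_subset[OF involutions_state, of s] by (simp add: walk_rel_state)

lemma curve_rel_sym [simp]: "curve_rel D s \<union> (curve_rel D s)\<inverse> = curve_rel D s"
  using involutions.walk_rel_converse[OF involutions_state, of s] by (simp add: walk_rel_state)

lemma conn_through: "h \<in> half_edges D \<Longrightarrow> (h, through D s h) \<in> conn (curve_rel D s)"
  by (simp add: conn_base curve_rel_iff)

lemma conn_glue: "h \<in> half_edges D \<Longrightarrow> (h, glue D h) \<in> conn (curve_rel D s)"
  by (simp add: conn_base curve_rel_iff)

lemma half_edge_real: "q \<in> real_crossings D \<Longrightarrow> (q, k) \<in> half_edges D"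
  using real_crossings by (auto simp: half_edges_def)

text \<open>Each of the two strands at \<open>q\<close> contains one of the ends \<open>0\<close>
  and \<open>2\<close>; joining these joins all four ends.\<close>

lemma joined_crossing:
  assumes q: "q \<in> real_crossings D" and r: "curve_rel D s \<subseteq> conn r" "((q, 0), (q, 2)) \<in> conn r"
  shows "((q, 0), (q, k)) \<in> conn r"
proof -
  have "((q, k), (q, splice_mate (s q) k)) \<in> conn r" for k
    using q r(1) half_edge_real[OF q, of k]
    by (auto simp: curve_rel_iff through_def dest!: subsetD)
  then show ?thesis using half_edge_4[of k "s q"] r(2)
    by (metis conn_refl conn_trans)
qed

text \<open>Only the steps through \<open>q\<close> change under the flip, and all ends at
  \<open>q\<close> are already connected.\<close>

lemma curve_rel_flip_subset:
  assumes q: "q \<in> real_crossings D" and r: "curve_rel D s \<subseteq> conn r" "((q, 0), (q, 2)) \<in> conn r"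
  shows "curve_rel D (flip s q) \<subseteq> conn r"
proof (rule subrelI)
  fix y z assume yz: "(y, z) \<in> curve_rel D (flip s q)"
  show "(y, z) \<in> conn r"
  proof (cases "fst y = q \<and> z = through D (flip s q) y")
    case True
    then obtain k k' where "y = (q, k)" "z = (q, k')" by (metis fst_through prod.collapse)
    then show ?thesis using joined_crossing[OF assms] by (meson conn_sym conn_trans)
  next
    case False
    then have "(y, z) \<in> curve_rel D s"
      using yz through_flip[of y q D s] by (auto simp: curve_rel_iff)
    then show ?thesis using r(1) by blast
  qed
qed

lemma flip_flip: "flip (flip s q) q = s"
  by (simp add: fun_upd_idem)

text \<open>Joining the two ends of the connecting arc makes the two splices indistinguishable, and drops
  the number of curves of either state by at most one.\<close>

lemma card_joined_flip:
  assumes "q \<in> real_crossings D"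
  shows "card (classes (half_edges D) (insert ((q, 0), (q, 2)) (curve_rel D (flip s q))))
       = card (classes (half_edges D) (insert ((q, 0), (q, 2)) (curve_rel D s)))"
proof -
  have *: "insert ((q, 0), (q, 2)) (curve_rel D (flip s q))
      \<subseteq> conn (insert ((q, 0), (q, 2)) (curve_rel D s))" for s
    using curve_rel_flip_subset[OF assms subset_conn_insert conn_base[OF insertI1]]
    by (simp add: conn_base)
  from *[of s] *[of "flip s q"] show ?thesis
    unfolding flip_flip by (intro card_classes_eq finite_half_edges)
qed

lemma num_curves_flip_le:
  assumes "q \<in> real_crossings D"
  shows "num_curves D (flip s q) \<le> Suc (num_curves D s)"
proof -
  let ?j = "insert ((q, 0::4), (q, 2))"
  have "card (classes (half_edges D) (curve_rel D (flip s q)))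
      \<le> Suc (card (classes (half_edges D) (?j (curve_rel D (flip s q)))))"
    by (rule card_classes_insert_le[OF finite_half_edges])
  also have "\<dots> \<le> Suc (card (classes (half_edges D) (curve_rel D s)))"
    unfolding card_joined_flip[OF assms]
    using card_classes_coarser[OF finite_half_edges subset_conn_insert] by blast
  finally show ?thesis by (simp add: num_curves_def state_curves_eq)
qed

lemma card_joined:
  assumes "q \<in> real_crossings D"
  shows "card (state_curves D s) =
    card (classes (half_edges D) (insert ((q, 0), (q, 2)) (curve_rel D s)))
      + (if ((q, 0), (q, 2)) \<in> conn (curve_rel D s) then 0 else 1)"
proof (cases "((q, 0), (q, 2)) \<in> conn (curve_rel D s)")
  case True
  then have "insert ((q, 0), (q, 2)) (curve_rel D s) \<subseteq> conn (curve_rel D s)"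
    using conn_base by auto
  then show ?thesis
    using card_classes_eq[OF finite_half_edges _ subset_conn_insert] True
    by (simp add: state_curves_eq)
next
  case False
  then show ?thesis
    using card_classes_insert_le[OF finite_half_edges, of "curve_rel D s"]
      card_classes_insert_less[OF finite_half_edges half_edge_real[OF assms] half_edge_real[OF assms]]
    by (simp add: state_curves_eq le_antisym)
qed

text \<open>Both counts exceed the same joined count, by 0 if the ends \<open>0\<close> and
  \<open>2\<close> share a curve and by 1 otherwise. The count grows only if the ends are together
  before the flip and apart after it.\<close>

lemma num_curves_flip_le_iff:
  assumes "q \<in> real_crossings D"
  shows "num_curves D (flip s q) \<le> num_curves D s \<longleftrightarrow>
    ((q, 0), (q, 2)) \<notin> conn (curve_rel D s) \<or> ((q, 0), (q, 2)) \<in> conn (curve_rel D (flip s q))"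
proof -
  let ?m = "card (classes (half_edges D) (insert ((q, 0), (q, 2)) (curve_rel D s)))"
  have "num_curves D s = ?m + (if ((q, 0), (q, 2)) \<in> conn (curve_rel D s) then 0 else 1) + circles D"
    unfolding num_curves_def card_joined[OF assms, of s] ..
  moreover have "num_curves D (flip s q) =
      ?m + (if ((q, 0), (q, 2)) \<in> conn (curve_rel D (flip s q)) then 0 else 1) + circles D"
    unfolding num_curves_def card_joined[OF assms, of "flip s q"] card_joined_flip[OF assms, of s] ..
  ultimately show ?thesis by (simp split: if_split)
qed

text \<open>If flipping the splice cut the curve in two, the halves could be oriented so as to induce an
  orientation of the original curve whose strands at the crossing are antiparallel.\<close>

lemma admissible_num_curves:
  assumes q: "q \<in> real_crossings D" and adm: "admissible D s q"
  shows "num_curves D (flip s q) \<le> num_curves D s"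
proof (rule ccontr)
  assume "\<not> ?thesis"
  then have same: "((q, 0), (q, 2)) \<in> conn (curve_rel D s)"
    and split: "((q, 0), (q, 2)) \<notin> conn (curve_rel D (flip s q))"
    by (simp_all add: num_curves_flip_le_iff[OF q])
  let ?C = "conn (curve_rel D s) `` {(q, 0)}"
  have curve: "C = ?C" if "C \<in> state_curves D s" "(q, 0) \<in> C \<or> (q, 2) \<in> C" for C
    using that class_of_mem[of C] same unfolding state_curves_eq by (metis conn_class_eq_iff)
  \<comment> \<open>Both ends of the arc lie on \<open>?C\<close>, which rules out the first
    alternative of \<open>admissible\<close>.\<close>
  with adm have par: "parallel_strands s q I" if "orientation D s ?C I" for I
    using that unfolding admissible_def by metis
  interpret flipped: involutions "half_edges D" "glue D" "through D (flip s q)"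
    by (rule involutions_state)
  \<comment> \<open>After the flip the ends \<open>0\<close> and \<open>2\<close> lie on different
    curves, which can be oriented to agree there.\<close>
  obtain I where I: "flipped.alternating I" and eq: "(q, 0) \<in> I \<longleftrightarrow> (q, 2) \<in> I"
    using flipped.alternating_separated[OF half_edge_real[OF q], of 0 "(q, 2)"] split
    by (auto simp: walk_rel_state)
  have flipped_t: "through D (flip s q) h \<in> I \<longleftrightarrow> h \<notin> I"
    and g: "glue D h \<in> I \<longleftrightarrow> h \<notin> I" if "h \<in> half_edges D" for h
    using I that unfolding flipped.alternating_def by blast+
  have t': "(q, splice_mate (other_splice (s q)) k) \<in> I \<longleftrightarrow> (q, k) \<notin> I" for k
    using flipped_t[OF half_edge_real[OF q, of k]] q by (simp add: through_def)
  \<comment> \<open>The opposite splice pairs \<open>0\<close> with the \<open>s\<close>-mate of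
    \<open>2\<close>, and \<open>2\<close> with that of \<open>0\<close>. As \<open>0\<close> and
    \<open>2\<close> agree in \<open>I\<close>, the \<open>s\<close>-mates are opposite as well, so
    \<open>I\<close> also alternates along the original curves.\<close>
  have t_q: "(q, splice_mate (s q) k) \<in> I \<longleftrightarrow> (q, k) \<notin> I" for k
    using half_edge_4[of k "s q"] t'[of 0] t'[of 2] eq unfolding splice_mate_other
    by (metis splice_mate_invol)
  have t: "through D s h \<in> I \<longleftrightarrow> h \<notin> I" if "h \<in> half_edges D" for h
  proof (cases "fst h = q")
    case True
    then show ?thesis using t_q[of "snd h"] q by (cases h) (simp add: through_def)
  next
    case False
    then show ?thesis using flipped_t[OF that] through_flip[of h q D s] by simp
  qed
  have C_sub: "?C \<subseteq> half_edges D"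
    using conn_closed[OF _ half_edge_real[OF q] curve_rel_subset] by blast
  have C_closed: "through D s h \<in> ?C" "glue D h \<in> ?C" if "h \<in> ?C" for h
    using that C_sub conn_through[of h s] conn_glue[of h s] conn_trans[of "(q, 0)" h "curve_rel D s"]
    by blast+
  have "orientation D s ?C (I \<inter> ?C)"
    unfolding orientation_def using C_sub C_closed t g by blast
  \<comment> \<open>Parallelism requires \<open>0\<close> and the \<open>s\<close>-mate of
    \<open>2\<close> to agree, but that mate is opposite to \<open>2\<close>, hence to
    \<open>0\<close>.\<close>
  from par[OF this] have "(q, 0) \<in> I \<inter> ?C \<longleftrightarrow> (q, splice_mate (s q) 2) \<in> I \<inter> ?C"
    unfolding parallel_strands_def by (metis splice_mate_other(1))
  moreover have "(q, 0) \<in> ?C" by simp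
  moreover have "(q, splice_mate (s q) 2) \<in> ?C"
    using C_closed(1)[of "(q, 2)"] same q by (simp add: through_def)
  ultimately show False using t_q[of 2] eq by blast
qed

end

section \<open>From pseudo-adequacy of \<open>D'\<close> to that of \<open>D\<close>\<close>

lemma link_diagram_virtual_link_diagram: "virtual_link_diagram D \<Longrightarrow> link_diagram D"
  by (auto simp: virtual_link_diagram_def link_diagram_def)

lemma virtualize_simps [simp]:
  "crossings (virtualize D p) = crossings D"
  "real_crossings (virtualize D p) = real_crossings D - {p}"
  "glue (virtualize D p) = glue D"
  "half_edges (virtualize D p) = half_edges D"
  by (simp_all add: virtualize_def half_edges_def)

lemma link_diagram_virtualize: "link_diagram D \<Longrightarrow> link_diagram (virtualize D p)"
  by (auto simp: link_diagram_def)

lemma num_splices_flip_const: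
  assumes "q \<in> real_crossings D"
  shows "num_splices D (flip (constant_state D x) q) (other_splice x) = 1"
proof -
  have "{c \<in> real_crossings D. flip (constant_state D x) q c = other_splice x} = {q}"
    using assms by (auto simp: constant_state_def) (metis other_splice_neq)
  then show ?thesis by (simp add: num_splices_def)
qed

lemma constant_state_mem: "constant_state D x \<in> states D"
  by (auto simp: states_def constant_state_def)

lemma flip_mem: "q \<in> real_crossings D \<Longrightarrow> s \<in> states D \<Longrightarrow> flip s q \<in> states D"
  by (auto simp: states_def PiE_def extensional_def)

lemma pseudo_adequate_flip:
  assumes "pseudo_adequate D" "q \<in> real_crossings D"
  shows "num_curves D (flip (constant_state D x) q) \<le> num_curves D (constant_state D x)"
proof (cases x)
  case ASplice
  then show ?thesis
    using assms flip_mem[OF assms(2) constant_state_mem, of x] num_splices_flip_const[OF assms(2), of x]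
    unfolding pseudo_adequate_def by (metis other_splice.simps)
next
  case BSplice
  then show ?thesis
    using assms flip_mem[OF assms(2) constant_state_mem, of x] num_splices_flip_const[OF assms(2), of x]
    unfolding pseudo_adequate_def by (metis other_splice.simps)
qed

text \<open>A flip increasing the count would cut one curve in two at an inadmissible arc. By
  \<open>adm\<close> that curve avoids \<open>p\<close>, so \<open>D'\<close> contains the same
  curve and the same cut, against its pseudo-adequacy.\<close>

lemma v_pseudo_adequate_flip:
  assumes D': "link_diagram D'" "pseudo_adequate D'" and D: "D = virtualize D' p"
    and adm: "\<forall>q \<in> real_crossings D.
       arc_ends_on q (\<Union> (curves_at D (constant_state D x) p)) \<longrightarrow> admissible D (constant_state D x) q"
    and q: "q \<in> real_crossings D"
  shows "num_curves D (flip (constant_state D x) q) \<le> num_curves D (constant_state D x)"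
proof (rule ccontr)
  let ?s = "constant_state D x" and ?s' = "constant_state D' x"
  interpret D': link_diagram D' by fact
  interpret link_diagram D using D' D by (simp add: link_diagram_virtualize)
  have q': "q \<in> real_crossings D'" "q \<noteq> p" using q D by auto
  assume bad: "\<not> ?thesis"
  then have same: "((q, 0), (q, 2)) \<in> conn (curve_rel D ?s)"
    and split: "((q, 0), (q, 2)) \<notin> conn (curve_rel D (flip ?s q))"
    by (simp_all add: num_curves_flip_le_iff[OF q])
  let ?C = "conn (curve_rel D ?s) `` {(q, 0)}"
  have C: "?C \<in> state_curves D ?s"
    unfolding state_curves_eq classes_image using half_edge_real[OF q] by blast
  have "\<not> admissible D ?s q"
    using bad admissible_num_curves[OF q] by blast
  then have "\<not> arc_ends_on q (\<Union> (curves_at D ?s p))" using adm q by blast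
  then have p: "(p, k) \<notin> ?C" for k
    using C same by (auto simp: arc_ends_on_def curves_at_def)
  \<comment> \<open>Virtualizing alters \<open>through\<close> only at \<open>p\<close>, and
    \<open>?C\<close> has no half-edge there.\<close>
  have agree: "(y, z) \<in> curve_rel D ?s \<longleftrightarrow> (y, z) \<in> curve_rel D' ?s'"
    "(y, z) \<in> curve_rel D (flip ?s q) \<longleftrightarrow> (y, z) \<in> curve_rel D' (flip ?s' q)"
    if "y \<in> ?C" for y z
  proof -
    have "fst y \<noteq> p" using p that by (cases y) auto
    then have "through D ?s y = through D' ?s' y"
      "through D (flip ?s q) y = through D' (flip ?s' q) y"
      using q q' by (auto simp: through_def D constant_state_def)
    then show "(y, z) \<in> curve_rel D ?s \<longleftrightarrow> (y, z) \<in> curve_rel D' ?s'"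
      "(y, z) \<in> curve_rel D (flip ?s q) \<longleftrightarrow> (y, z) \<in> curve_rel D' (flip ?s' q)"
      by (simp_all add: curve_rel_iff D)
  qed
  have q0: "(q, 0) \<in> ?C" by simp
  \<comment> \<open>The flip at \<open>q\<close> only reconnects ends that already lie on
    \<open>?C\<close>, so the resulting pieces stay inside \<open>?C\<close> and avoid
    \<open>p\<close> too.\<close>
  have closed: "curve_rel D (flip ?s q) `` ?C \<subseteq> ?C"
  proof
    fix z assume "z \<in> curve_rel D (flip ?s q) `` ?C"
    then obtain y where "y \<in> ?C" "(y, z) \<in> curve_rel D (flip ?s q)" by blast
    moreover from this(2) have "(y, z) \<in> conn (curve_rel D ?s)"
      by (rule subsetD[OF curve_rel_flip_subset[OF q subset_conn same]])
    ultimately show "z \<in> ?C" using conn_trans by (metis Image_singleton_iff)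
  qed
  have "?C = conn (curve_rel D' ?s') `` {(q, 0)}"
    using conn_class_local[OF q0 class_closed, of "curve_rel D' ?s'"] agree(1) by simp
  then have "((q, 0), (q, 2)) \<in> conn (curve_rel D' ?s')"
    using same by (metis Image_singleton_iff)
  moreover have "conn (curve_rel D (flip ?s q)) `` {(q, 0)} = conn (curve_rel D' (flip ?s' q)) `` {(q, 0)}"
    by (rule conn_class_local[OF q0]) (use closed agree(2) in simp_all)
  then have "((q, 0), (q, 2)) \<notin> conn (curve_rel D' (flip ?s' q))"
    using split by (metis Image_singleton_iff)
  ultimately show False
    using pseudo_adequate_flip[OF D'(2) q'(1), of x] D'.num_curves_flip_le_iff[OF q'(1)] by blast
qed

section \<open>Extreme degrees of the bracket\<close>

lemma lookup_A_pow_mult: "Poly_Mapping.lookup (A_pow a * f) j = Poly_Mapping.lookup f (j - a)"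
proof -
  have "j = a + q \<longleftrightarrow> q = j - a" for q by auto
  then show ?thesis
    unfolding A_pow_def lookup_mult lookup_single when_mult by simp
qed

text \<open>Each further factor gives minus the sum of the shifts by 2 and by -2; at an extreme
  degree of the product only one shift is nonzero.\<close>

lemma lookup_loop_power:
  fixes m :: nat
  defines "f \<equiv> (- A_pow 2 - A_pow (- 2)) ^ m"
  shows "\<bar>j\<bar> > 2 * int m \<Longrightarrow> Poly_Mapping.lookup f j = 0"
    and "\<bar>j\<bar> = 2 * int m \<Longrightarrow> Poly_Mapping.lookup f j = (- 1) ^ m"
proof -
  have "(\<bar>j\<bar> > 2 * int m \<longrightarrow> Poly_Mapping.lookup ((- A_pow 2 - A_pow (- 2)) ^ m) j = 0) \<and>
        (\<bar>j\<bar> = 2 * int m \<longrightarrow> Poly_Mapping.lookup ((- A_pow 2 - A_pow (- 2)) ^ m) j = (- 1) ^ m)" for j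
  proof (induction m arbitrary: j)
    case 0
    show ?case by (auto simp: lookup_one)
  next
    case (Suc m)
    let ?d = "- A_pow 2 - A_pow (- 2)"
    have "?d ^ Suc m = - (A_pow 2 * ?d ^ m) - A_pow (- 2) * ?d ^ m"
      by (simp add: algebra_simps)
    then have "Poly_Mapping.lookup (?d ^ Suc m) j = - Poly_Mapping.lookup (?d ^ m) (j - 2) - Poly_Mapping.lookup (?d ^ m) (j + 2)"
      by (simp add: lookup_minus lookup_A_pow_mult)
    then show ?case using Suc.IH[of "j - 2"] Suc.IH[of "j + 2"] by (auto simp: abs_if split: if_splits)
  qed
  then show "\<bar>j\<bar> > 2 * int m \<Longrightarrow> Poly_Mapping.lookup f j = 0" "\<bar>j\<bar> = 2 * int m \<Longrightarrow> Poly_Mapping.lookup f j = (- 1) ^ m"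
    unfolding f_def by blast+
qed

context link_diagram
begin

lemma finite_states: "finite (states D)"
proof -
  have "(UNIV :: splice set) = {ASplice, BSplice}" using splice.exhaust by auto
  then have "finite (UNIV :: splice set)" by (metis finite.emptyI finite.insertI)
  then show ?thesis unfolding states_def by (intro finite_PiE finite_real_crossings) 
qed

lemma num_splices_sum: "num_splices D s x + num_splices D s (other_splice x) = card (real_crossings D)"
proof -
  have "{c \<in> real_crossings D. s c = x} \<union> {c \<in> real_crossings D. s c = other_splice x} = real_crossings D"
    by auto (metis other_splice.simps splice.exhaust)
  then show ?thesis
    unfolding num_splices_def using finite_real_crossings
    by (subst card_Un_disjoint[symmetric]) (auto, metis other_splice_neq)
qed

lemma num_splices_constant [simp]:
  "num_splices D (constant_state D x) x = card (real_crossings D)"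
proof -
  have "{c \<in> real_crossings D. constant_state D x c = x} = real_crossings D"
    by (auto simp: constant_state_def)
  then show ?thesis by (simp add: num_splices_def)
qed

lemma num_splices_other_eq_0:
  assumes "s \<in> states D" "num_splices D s (other_splice x) = 0"
  shows "s = constant_state D x"
proof
  fix c
  have "{c \<in> real_crossings D. s c = other_splice x} = {}"
    using assms(2) finite_real_crossings unfolding num_splices_def by simp
  then have "c \<in> real_crossings D \<Longrightarrow> s c = x"
    by (cases "s c"; cases x) auto
  then show "s c = constant_state D x c"
    using assms(1) PiE_arb[of s "real_crossings D" "\<lambda>_. UNIV" c]
    by (simp add: constant_state_def states_def)
qed

text \<open>Change the splices one at a time, starting from the constant state: the first flip gains
  no curve by \<open>flip\<close>, every later one at most one.\<close>

lemma num_curves_bound: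
  assumes flip: "\<And>q. q \<in> real_crossings D \<Longrightarrow>
      num_curves D (flip (constant_state D x) q) \<le> num_curves D (constant_state D x)"
    and s: "s \<in> states D" and k: "num_splices D s (other_splice x) \<noteq> 0"
  shows "num_curves D s < num_curves D (constant_state D x) + num_splices D s (other_splice x)"
proof -
  \<comment> \<open>The intermediate states: \<open>S\<close> is the set of crossings already
    flipped.\<close>
  define st where "st S = (\<lambda>c \<in> real_crossings D. if c \<in> S then other_splice x else x)" for S
  have step: "st (insert q S) = flip (st S) q" if "q \<in> real_crossings D" "q \<notin> S" for q S
    using that by (auto simp: st_def)
  have empty: "st {} = constant_state D x" by (auto simp: st_def constant_state_def)
  have bound: "num_curves D (st S) < num_curves D (constant_state D x) + card S"
    if "finite S" "S \<noteq> {}" "S \<subseteq> real_crossings D" for S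
    using that
  proof (induction rule: finite_ne_induct)
    case (singleton q)
    then have "st {q} = flip (constant_state D x) q"
      using step[of q "{}"] unfolding empty by blast
    then have "num_curves D (st {q}) \<le> num_curves D (constant_state D x)"
      using singleton flip[of q] by simp
    then show ?case by simp
  next
    case (insert q S)
    then have "num_curves D (st (insert q S)) \<le> Suc (num_curves D (st S))"
      using step[of q S] num_curves_flip_le[of q "st S"] by simp
    then show ?case using insert by simp
  qed
  let ?S = "{c \<in> real_crossings D. s c = other_splice x}"
  have "s c = st ?S c" for c
  proof (cases "c \<in> real_crossings D")
    case True
    moreover have "s c = x \<or> s c = other_splice x"
      by (metis other_splice.simps splice.exhaust)
    ultimately show ?thesis by (auto simp: st_def)
  next
    case False
    then show ?thesis using PiE_arb[of s "real_crossings D" "\<lambda>_. UNIV" c] s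
      by (simp add: st_def states_def)
  qed
  then have "s = st ?S" ..
  moreover have "?S \<noteq> {}" using k unfolding num_splices_def by (metis card.empty)
  ultimately show ?thesis
    using bound[of ?S] finite_real_crossings by (auto simp: num_splices_def)
qed

text \<open>Ensures that the subtraction of 1 in the exponent of \<open>bracket_state\<close> does
  not truncate.\<close>

lemma num_curves_pos:
  assumes "crossings D \<noteq> {}"
  shows "0 < num_curves D s"
proof -
  have "half_edges D \<noteq> {}" using assms by (auto simp: half_edges_def)
  then have "state_curves D s \<noteq> {}" unfolding state_curves_eq classes_image by simp
  then show ?thesis
    using finite_classes[OF finite_half_edges] by (simp add: num_curves_def state_curves_eq card_gt_0_iff)
qed

section \<open>Coefficients of the bracket at its extreme degrees\<close>

lemma lookup_bracket_state:
  "Poly_Mapping.lookup (bracket_state D s) j = Poly_Mapping.lookup ((- A_pow 2 - A_pow (- 2)) ^ (num_curves D s - 1))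
     (j - (int (num_splices D s ASplice) - int (num_splices D s BSplice)))"
  by (simp add: bracket_state_def lookup_A_pow_mult)

lemma lookup_bracket: "Poly_Mapping.lookup (bracket D) j = (\<Sum>s \<in> states D. Poly_Mapping.lookup (bracket_state D s) j)"
  by (simp add: bracket_def lookup_sum)

text \<open>The sign \<open>\<epsilon>\<close> treats the top degree (splice A) and the bottom
  degree (splice B) together. With \<open>k\<close> flipped splices the extreme degree of a summand,
  measured in direction \<open>\<epsilon>\<close>, is \<open>n - 2 k + 2 (N - 1)\<close>; by
  \<open>num_curves_bound\<close> it is at least 2 below \<open>?M\<close> when
  \<open>k > 0\<close>.\<close>

lemma bracket_state_extreme:
  fixes j \<epsilon> :: int
  assumes "crossings D \<noteq> {}"
    and flip: "\<And>q. q \<in> real_crossings D \<Longrightarrow>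
      num_curves D (flip (constant_state D x) q) \<le> num_curves D (constant_state D x)"
    and s: "s \<in> states D"
    and x: "x = ASplice \<and> \<epsilon> = 1 \<or> x = BSplice \<and> \<epsilon> = - 1"
    and j: "\<epsilon> * j \<ge> int (card (real_crossings D)) + 2 * (int (num_curves D (constant_state D x)) - 1)"
      (is "_ \<ge> ?M")
  shows "Poly_Mapping.lookup (bracket_state D s) j =
    (if s = constant_state D x \<and> \<epsilon> * j = ?M then (- 1) ^ (num_curves D s - 1) else 0)"
proof -
  define \<delta> where "\<delta> = int (num_splices D s ASplice) - int (num_splices D s BSplice)"
  let ?k = "num_splices D s (other_splice x)"
  have \<delta>: "\<epsilon> * \<delta> = int (card (real_crossings D)) - 2 * int ?k"
    using x num_splices_sum[of s x] by (auto simp: \<delta>_def)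
  have abs: "\<bar>j - \<delta>\<bar> \<ge> \<epsilon> * j - \<epsilon> * \<delta>" and abs_eq: "\<bar>j - \<delta>\<bar> = \<bar>\<epsilon> * j - \<epsilon> * \<delta>\<bar>"
    using x by auto
  have pos: "0 < num_curves D s" by (rule num_curves_pos[OF assms(1)])
  have coeff: "Poly_Mapping.lookup (bracket_state D s) j
      = Poly_Mapping.lookup ((- A_pow 2 - A_pow (- 2)) ^ (num_curves D s - 1)) (j - \<delta>)"
    by (simp add: lookup_bracket_state \<delta>_def)
  have int_pos: "int (num_curves D s - 1) = int (num_curves D s) - 1" using pos by simp
  show ?thesis
  proof (cases "s = constant_state D x")
    case True
    then have "?k = 0" using num_splices_sum[of s x] by simp
    show ?thesis
    proof (cases "\<epsilon> * j = ?M")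
      case eq: True
      then have "\<bar>j - \<delta>\<bar> = 2 * int (num_curves D s - 1)"
        unfolding abs_eq \<delta> int_pos using True \<open>?k = 0\<close> pos by simp
      then show ?thesis using eq True lookup_loop_power(2) coeff by simp
    next
      case False
      then have "\<bar>j - \<delta>\<bar> > 2 * int (num_curves D s - 1)"
        unfolding int_pos using abs \<delta> True \<open>?k = 0\<close> j by simp
      then show ?thesis using False lookup_loop_power(1) coeff by simp
    qed
  next
    case False
    then have "?k \<noteq> 0" using num_splices_other_eq_0[OF s] by blast
    with s flip have "num_curves D s < num_curves D (constant_state D x) + ?k"
      by (intro num_curves_bound)
    then have "int (num_curves D s) < int (num_curves D (constant_state D x)) + int ?k"
      by linarith
    then have "\<bar>j - \<delta>\<bar> > 2 * int (num_curves D s - 1)"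
      unfolding int_pos using abs \<delta> j by (smt (verit))
    then show ?thesis using False lookup_loop_power(1) coeff by simp
  qed
qed

text \<open>Only the constant state reaches degree \<open>?M\<close>, and its coefficient there is a
  sign, so nothing cancels.\<close>

lemma lookup_bracket_extreme:
  fixes j \<epsilon> :: int
  assumes "crossings D \<noteq> {}"
    and flip: "\<And>q. q \<in> real_crossings D \<Longrightarrow>
      num_curves D (flip (constant_state D x) q) \<le> num_curves D (constant_state D x)"
    and x: "x = ASplice \<and> \<epsilon> = 1 \<or> x = BSplice \<and> \<epsilon> = - 1"
    and j: "\<epsilon> * j \<ge> int (card (real_crossings D)) + 2 * (int (num_curves D (constant_state D x)) - 1)"
      (is "_ \<ge> ?M")
  shows "Poly_Mapping.lookup (bracket D) j \<noteq> 0 \<longleftrightarrow> \<epsilon> * j = ?M"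
proof -
  have "Poly_Mapping.lookup (bracket D) j = (\<Sum>s \<in> states D. if s = constant_state D x
      then (if \<epsilon> * j = ?M then (- 1) ^ (num_curves D s - 1) else 0) else 0)"
    unfolding lookup_bracket using bracket_state_extreme[OF assms(1) flip _ x j]
    by (intro sum.cong) auto
  also have "\<dots> = (if \<epsilon> * j = ?M then (- 1) ^ (num_curves D (constant_state D x) - 1) else 0)"
    using finite_states constant_state_mem[of D x] by (simp add: sum.delta)
  finally show ?thesis by simp
qed

lemma laurent_span_bracket:
  assumes "crossings D \<noteq> {}"
    and flip: "\<And>x q. q \<in> real_crossings D \<Longrightarrow>
      num_curves D (flip (constant_state D x) q) \<le> num_curves D (constant_state D x)"
  shows "laurent_span (bracket D) = 2 * int (card (real_crossings D))
     + 2 * (int (num_curves D (state_A D)) + int (num_curves D (state_B D)) - 2)"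
proof -
  define M where "M x = int (card (real_crossings D)) + 2 * (int (num_curves D (constant_state D x)) - 1)" for x
  have A: "Poly_Mapping.lookup (bracket D) j \<noteq> 0 \<longleftrightarrow> j = M ASplice" if "j \<ge> M ASplice" for j
    using lookup_bracket_extreme[OF assms(1), of ASplice 1 j] flip that by (simp add: M_def)
  have B: "Poly_Mapping.lookup (bracket D) j \<noteq> 0 \<longleftrightarrow> j = - M BSplice" if "j \<le> - M BSplice" for j
    using lookup_bracket_extreme[OF assms(1), of BSplice "- 1" j] flip that by (auto simp: M_def)
  let ?K = "Poly_Mapping.keys (bracket D)"
  \<comment> \<open>In either direction nothing lies beyond the extreme degree, and that degree
    itself occurs.\<close>
  have "Max ?K = M ASplice"
    using A by (intro Max_eqI) (auto simp: in_keys_iff intro: linear le_cases)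
  moreover have "Min ?K = - M BSplice"
    using B by (intro Min_eqI) (auto simp: in_keys_iff intro: le_cases)
  ultimately show ?thesis by (simp add: laurent_span_def M_def)
qed

end

section \<open>The Euler characteristic of the Turaev surface\<close>

lemma minus_1_4 [simp]: "- 1 = (3::4)"
  by simp

lemma ex_splice: "(\<exists>x. P x) \<longleftrightarrow> P ASplice \<or> P BSplice"
  by (metis splice.exhaust)

definition arc_rel :: "'c virtual_diagram \<Rightarrow> ('c half_edge \<times> 'c half_edge) set" where
  "arc_rel D = glue_rel D \<union> virtual_rel D"

lemma arcs_eq: "arcs D = {a \<in> classes (half_edges D) (arc_rel D). a \<inter> real_half_edges D \<noteq> {}}"
  by (simp add: arcs_def arc_rel_def)

text \<open>\<open>corner x h\<close> is the corner of the colour of the splice \<open>x\<close> next to the band at \<open>h\<close>; it stands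
  for the strand of the \<open>x\<close>-splice through \<open>h\<close>.\<close>

definition corner :: "splice \<Rightarrow> 'c half_edge \<Rightarrow> 'c half_edge" where
  "corner x h = (fst h, if splice_mate x (snd h) = snd h + 1 then snd h else snd h - 1)"

definition corners :: "'c virtual_diagram \<Rightarrow> splice \<Rightarrow> 'c half_edge set" where
  "corners D x = {h \<in> real_half_edges D. splice_mate x (snd h) = snd h + 1}"

lemma corner_mem: "h \<in> real_half_edges D \<Longrightarrow> corner x h \<in> corners D x"
  using exhaust_4[of "snd h"]
  by (cases x) (auto simp: corner_def corners_def real_half_edges_def)

lemma corner_corners: "h \<in> corners D x \<Longrightarrow> corner x h = h"
  by (simp add: corner_def corners_def)

text \<open>This makes \<open>corner x\<close> well defined on strands: both ends of a strand of the
  \<open>x\<close>-splice border the same corner.\<close>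

lemma corner_mate: "corner x (c, splice_mate x k) = corner x (c, k)"
  using exhaust_4[of k] by (cases x) (auto simp: corner_def)

lemma corner_cases: "corner x (c, k) = (c, k) \<or> corner x (c, k) = (c, splice_mate x k)"
  using exhaust_4[of k] by (cases x) (auto simp: corner_def)

lemma corners_Un: "corners D ASplice \<union> corners D BSplice = real_half_edges D"
proof -
  have "splice_mate ASplice k = k + 1 \<or> splice_mate BSplice k = k + 1" for k
    using exhaust_4[of k] by auto
  then show ?thesis by (auto simp: corners_def)
qed

lemma corners_disjoint: "h \<in> corners D x \<Longrightarrow> h \<in> corners D y \<Longrightarrow> x = y"
  using exhaust_4[of "snd h"] by (cases x; cases y) (auto simp: corners_def)

text \<open>The half twist is chosen so that colours match. In both cases the band joins, for each
  colour, the corner of that colour at one end to the one at the other end.\<close>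

lemma band_corners:
  "(if half_twisted (c, k) (c', k')
         then (x, y) \<in> {((c, k), (c', k')), ((c, k - 1), (c', k' - 1))}
         else (x, y) \<in> {((c, k), (c', k' - 1)), ((c, k - 1), (c', k'))}) \<longleftrightarrow>
   (\<exists>z. x = corner z (c, k) \<and> y = corner z (c', k'))" (is "?l \<longleftrightarrow> ?r")
proof -
  have "?r \<longleftrightarrow> x = corner ASplice (c, k) \<and> y = corner ASplice (c', k') \<or>
    x = corner BSplice (c, k) \<and> y = corner BSplice (c', k')"
    by (simp add: ex_splice)
  also have "\<dots> \<longleftrightarrow> ?l"
    using exhaust_4[of k] exhaust_4[of k']
    by (elim disjE) (auto simp: half_twisted_def red_corner_def corner_def)
  finally show ?thesis by blast
qed

lemma corner_rel_eq:
  "corner_rel D = {(corner x h, corner x h') | x h h'. joined_by_arc D h h'}"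
  unfolding corner_rel_def band_corners by (auto; metis prod.collapse)

context link_diagram
begin

section \<open>Boundary components as curves of the two constant states\<close>

lemma arc_rel_subset: "arc_rel D \<subseteq> half_edges D \<times> half_edges D"
proof (rule subrelI)
  fix y z assume "(y, z) \<in> arc_rel D"
  then show "(y, z) \<in> half_edges D \<times> half_edges D"
    using glue_mem[of y] by (auto simp: arc_rel_def glue_rel_def virtual_rel_def half_edges_def)
qed

lemma joined_by_arc_iff:
  "joined_by_arc D h h' \<longleftrightarrow>
     h \<noteq> h' \<and> h \<in> real_half_edges D \<and> h' \<in> real_half_edges D \<and> (h, h') \<in> conn (arc_rel D)"
proof -
  have "(\<exists>a \<in> arcs D. h \<in> a \<and> h' \<in> a) \<longleftrightarrow> (h, h') \<in> conn (arc_rel D)"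
    if h: "h \<in> real_half_edges D"
  proof
    assume "\<exists>a \<in> arcs D. h \<in> a \<and> h' \<in> a"
    then obtain a where a: "a \<in> classes (half_edges D) (arc_rel D)" "h \<in> a" "h' \<in> a"
      by (auto simp: arcs_eq)
    then show "(h, h') \<in> conn (arc_rel D)" using class_of_mem[OF a(1,2)] by simp
  next
    assume "(h, h') \<in> conn (arc_rel D)"
    moreover have "conn (arc_rel D) `` {h} \<in> arcs D"
      using h real_half_edges_subset conn_refl[of h "arc_rel D"] unfolding arcs_eq classes_image by blast
    ultimately show "\<exists>a \<in> arcs D. h \<in> a \<and> h' \<in> a"
      by (intro bexI[of _ "conn (arc_rel D) `` {h}"]) simp_all
  qed
  then show ?thesis unfolding joined_by_arc_def by blast
qed

text \<open>At a virtual crossing every state goes straight, so the choice of \<open>s\<close> is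
  free and arcs become pieces of the curves of any state.\<close>

lemma arc_rel_iff:
  "(y, z) \<in> arc_rel D \<longleftrightarrow>
     y \<in> half_edges D \<and> (z = glue D y \<or> y \<notin> real_half_edges D \<and> z = through D s y)"
  by (cases y; cases z) (auto simp: arc_rel_def glue_rel_def virtual_rel_def half_edges_def
      real_half_edges_def through_def)

lemma arc_rel_curve: "arc_rel D \<subseteq> conn (curve_rel D s)"
proof (rule subrelI)
  fix y z assume "(y, z) \<in> arc_rel D"
  then have "(y, z) \<in> curve_rel D s" using arc_rel_iff[of y z s] by (auto simp: curve_rel_iff)
  then show "(y, z) \<in> conn (curve_rel D s)" by (rule conn_base)
qed

lemma corner_rel_arc:
  assumes "h \<in> real_half_edges D" "h' \<in> real_half_edges D" "(h, h') \<in> conn (arc_rel D)"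
  shows "(corner x h, corner x h') \<in> conn (corner_rel D)"
proof (cases "h = h'")
  case False
  then have "(corner x h, corner x h') \<in> corner_rel D"
    using assms unfolding corner_rel_eq joined_by_arc_iff by blast
  then show ?thesis by (rule conn_base)
qed simp

lemma corner_curve:
  assumes "h \<in> real_half_edges D"
  shows "(h, corner x h) \<in> conn (curve_rel D (constant_state D x))"
proof -
  obtain c k where h: "h = (c, k)" by (cases h)
  then have "c \<in> real_crossings D" using assms by (simp add: real_half_edges_def)
  then show ?thesis
    using corner_cases[of x c k] conn_through[of h "constant_state D x"] assms real_half_edges_subset
    by (auto simp: h through_def constant_state_def)
qed

text \<open>A boundary step keeps its colour \<open>x\<close> and follows an arc, which is part of a
  curve of the constant state for \<open>x\<close>.\<close>

lemma corner_rel_step: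
  assumes "(y, z) \<in> corner_rel D \<or> (z, y) \<in> corner_rel D" "y \<in> corners D x"
  shows "z \<in> corners D x \<and> (y, z) \<in> conn (curve_rel D (constant_state D x))"
proof -
  have "\<exists>x' h h'. joined_by_arc D h h' \<and> y = corner x' h \<and> z = corner x' h'"
  proof -
    from assms(1) obtain x' h h' where "joined_by_arc D h h'"
      "y = corner x' h \<and> z = corner x' h' \<or> z = corner x' h \<and> y = corner x' h'"
      unfolding corner_rel_eq by blast
    moreover have "joined_by_arc D h' h"
      using calculation(1) unfolding joined_by_arc_iff by (metis conn_sym)
    ultimately show ?thesis by blast
  qed
  then obtain x' h h' where hh: "h \<in> real_half_edges D" "h' \<in> real_half_edges D"
      "(h, h') \<in> conn (arc_rel D)" and yz: "y = corner x' h" "z = corner x' h'"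
    unfolding joined_by_arc_iff by blast
  have x: "x' = x" using corners_disjoint[OF _ assms(2)] corner_mem[OF hh(1), of x'] yz(1) by blast
  have "(h, h') \<in> conn (curve_rel D (constant_state D x))"
    by (rule subsetD[OF conn_mono[OF arc_rel_curve] hh(3)])
  then have "(y, z) \<in> conn (curve_rel D (constant_state D x))"
    using corner_curve[OF hh(1), of x] corner_curve[OF hh(2), of x] unfolding yz x
    by (metis conn_sym conn_trans)
  then show ?thesis using corner_mem[OF hh(2), of x] yz x by blast
qed

lemma conn_corner_rel_curve:
  assumes "(y, z) \<in> conn (corner_rel D)" "y \<in> corners D x"
  shows "z \<in> corners D x \<and> (y, z) \<in> conn (curve_rel D (constant_state D x))"
  using assms(1)
proof (induction rule: conn_induct)
  case (step z w)
  then show ?case using corner_rel_step[of z w x] conn_trans by metis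
next
  case (backstep z w)
  then show ?case using corner_rel_step[of z w x] conn_trans by metis
qed (use assms(2) in simp)

text \<open>Follow the curve from \<open>y\<close> to \<open>z\<close>; the boundary connection is
  carried along each arc and across each strand.\<close>

lemma conn_curve_corner_rel:
  assumes "(y, z) \<in> conn (curve_rel D (constant_state D x))" "y \<in> corners D x" "z \<in> corners D x"
  shows "(y, z) \<in> conn (corner_rel D)"
proof -
  let ?r = "curve_rel D (constant_state D x)"
  have real: "y \<in> real_half_edges D" "z \<in> real_half_edges D"
    using assms(2,3) by (simp_all add: corners_def)
  \<comment> \<open>Half-edges at virtual crossings have no corner, so the invariant speaks of the
    real ends of the arc through \<open>w\<close>.\<close>
  define near where "near w \<longleftrightarrow> (\<forall>h \<in> real_half_edges D. (w, h) \<in> conn (arc_rel D) \<longrightarrow>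
      (y, corner x h) \<in> conn (corner_rel D))" for w
  have near_step: "near v" if "near w" "(w, v) \<in> ?r" for w v
  proof (cases "(w, v) \<in> conn (arc_rel D)")
    case True
    then show ?thesis using that(1) conn_trans[OF True] unfolding near_def by blast
  next
    case False
    obtain c k where w: "w = (c, k)" by (cases w)
    \<comment> \<open>A curve leaves its arc only along a strand at a real crossing, whose two ends
      share a corner.\<close>
    have "(w, v) \<notin> arc_rel D" using False conn_base[of w v "arc_rel D"] by blast
    then have "w \<in> real_half_edges D" "v = through D (constant_state D x) w"
      using that(2) arc_rel_iff[of w v "constant_state D x"] unfolding curve_rel_iff by blast+
    then have c: "c \<in> real_crossings D" and v: "v = (c, splice_mate x k)"
      unfolding w by (simp_all add: real_half_edges_def through_def constant_state_def)
    have vw: "v \<in> real_half_edges D" "w \<in> real_half_edges D"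
      using c by (auto simp: v w real_half_edges_def)
    have "(y, corner x w) \<in> conn (corner_rel D)"
      using that(1) vw(2) conn_refl[of w "arc_rel D"] unfolding near_def by blast
    then have "(y, corner x v) \<in> conn (corner_rel D)"
      by (simp add: v w corner_mate)
    then show ?thesis
      using corner_rel_arc[OF vw(1)] conn_trans unfolding near_def by metis
  qed
  have near_y: "near y"
    using corner_rel_arc[OF real(1), of _ x] corner_corners[OF assms(2)] unfolding near_def by metis
  from assms(1) have "near z"
  proof (induction rule: conn_induct)
    case (step w v)
    then show ?case using near_step by blast
  next
    case (backstep w v)
    then have "(w, v) \<in> ?r" using curve_rel_sym[of "constant_state D x"] by blast
    then show ?case using near_step backstep(3) by blast
  qed (rule near_y)
  then show ?thesis
    using real(2) corner_corners[OF assms(3)] conn_refl[of z "arc_rel D"] unfolding near_def by metis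
qed

lemma real_curves_card:
  "card {C \<in> state_curves D (constant_state D x). C \<inter> real_half_edges D \<noteq> {}}
     = card {C \<in> boundary_components D. C \<inter> corners D x \<noteq> {}}"
proof -
  \<comment> \<open>Each strand at a real crossing contains the half-edge that represents its
    corner.\<close>
  have "C \<inter> real_half_edges D \<noteq> {} \<longleftrightarrow> C \<inter> corners D x \<noteq> {}"
    if C: "C \<in> state_curves D (constant_state D x)" for C
  proof
    assume "C \<inter> real_half_edges D \<noteq> {}"
    then obtain h where h: "h \<in> C" "h \<in> real_half_edges D" by blast
    then have "corner x h \<in> C"
      using corner_curve[OF h(2), of x] class_of_mem[OF C[unfolded state_curves_eq] h(1)] by blast
    then show "C \<inter> corners D x \<noteq> {}" using corner_mem[OF h(2)] by blast
  qed (auto simp: corners_def)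
  then have "{C \<in> state_curves D (constant_state D x). C \<inter> real_half_edges D \<noteq> {}} =
    {C \<in> classes (half_edges D) (curve_rel D (constant_state D x)). C \<inter> corners D x \<noteq> {}}"
    unfolding state_curves_eq by blast
  also have "card \<dots> = card {C \<in> classes (real_half_edges D) (corner_rel D). C \<inter> corners D x \<noteq> {}}"
  proof (rule card_classes_meeting)
    show "corners D x \<subseteq> half_edges D" "corners D x \<subseteq> real_half_edges D"
      using real_half_edges_subset by (auto simp: corners_def)
  qed (use conn_curve_corner_rel conn_corner_rel_curve in blast)
  finally show ?thesis by (simp add: boundary_components_def)
qed

text \<open>Every boundary component is of one colour, so the red and the blue components can be
  counted separately.\<close>

lemma boundary_components_card:
  "card (boundary_components D) = (\<Sum>x \<in> {ASplice, BSplice}.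
     card {C \<in> state_curves D (constant_state D x). C \<inter> real_half_edges D \<noteq> {}})"
proof -
  let ?B = "\<lambda>x. {C \<in> boundary_components D. C \<inter> corners D x \<noteq> {}}"
  have fin: "finite (boundary_components D)"
    unfolding boundary_components_def
    using finite_classes finite_subset[OF real_half_edges_subset finite_half_edges] by blast
  have "boundary_components D = ?B ASplice \<union> ?B BSplice"
  proof -
    have "C \<inter> real_half_edges D \<noteq> {}" if C: "C \<in> boundary_components D" for C
    proof -
      obtain h where "h \<in> real_half_edges D" "C = conn (corner_rel D) `` {h}"
        using C unfolding boundary_components_def classes_image by blast
      then have "h \<in> C \<inter> real_half_edges D" by simp
      then show ?thesis by blast
    qed
    then show ?thesis using corners_Un by blast
  qed
  moreover have "?B ASplice \<inter> ?B BSplice = {}"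
  proof -
    have False if C: "C \<in> boundary_components D" and y: "y \<in> C" "y \<in> corners D ASplice"
      and z: "z \<in> C" "z \<in> corners D BSplice" for C y z
    proof -
      have "(y, z) \<in> conn (corner_rel D)"
        using class_of_mem[OF C[unfolded boundary_components_def] y(1)] z(1) by blast
      then show False using conn_corner_rel_curve[OF _ y(2)] corners_disjoint[OF _ z(2)] by blast
    qed
    then show ?thesis by blast
  qed
  ultimately have "card (boundary_components D) = card (?B ASplice) + card (?B BSplice)"
    using fin by (metis (no_types, lifting) card_Un_disjoint finite_Un)
  then show ?thesis by (simp add: real_curves_card)
qed

text \<open>A curve avoiding all real crossings continues straight everywhere, whether it is traced
  in the state or in \<open>D\<close> itself.\<close>

lemma virtual_curves:
  "{C \<in> state_curves D s. C \<inter> real_half_edges D = {}} =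
   {C \<in> link_components D. C \<inter> real_half_edges D = {}}"
proof -
  define r where "r = glue_rel D \<union> {((c, k), (c, k + 2)) | c k. c \<in> crossings D}"
  have r_iff: "(y, z) \<in> r \<longleftrightarrow> y \<in> half_edges D \<and> (z = glue D y \<or> z = (fst y, snd y + 2))" for y z
    by (cases y; cases z) (auto simp: r_def glue_rel_def half_edges_def)
  have r_sym: "r \<union> r\<inverse> = r"
  proof -
    have "(z, y) \<in> r" if "(y, z) \<in> r" for y z
      using that glue_mem[of y] glue_glue[of y] unfolding r_iff
      by (cases y; cases z) (auto simp: half_edges_def add.assoc)
    then show ?thesis by blast
  qed
  have link: "link_components D = classes (half_edges D) r"
    by (simp add: link_components_def r_def)
  have agree: "(y, z) \<in> curve_rel D s \<longleftrightarrow> (y, z) \<in> r" if "y \<notin> real_half_edges D" for y z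
    using that unfolding r_iff curve_rel_iff by (cases y) (auto simp: through_def real_half_edges_def)
  have *: "conn (curve_rel D s) `` {h} = conn r `` {h}"
    if "conn (curve_rel D s) `` {h} \<inter> real_half_edges D = {}" for h
  proof (rule conn_class_local[OF _ class_closed])
    show "h \<in> conn (curve_rel D s) `` {h}" by simp
    fix y z assume "y \<in> conn (curve_rel D s) `` {h}"
    then have "y \<notin> real_half_edges D" using that by blast
    then show "(y, z) \<in> curve_rel D s \<union> (curve_rel D s)\<inverse> \<longleftrightarrow> (y, z) \<in> r \<union> r\<inverse>"
      unfolding r_sym curve_rel_sym by (rule agree)
  qed
  have **: "conn r `` {h} = conn (curve_rel D s) `` {h}"
    if "conn r `` {h} \<inter> real_half_edges D = {}" for h
  proof (rule conn_class_local[OF _ class_closed])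
    show "h \<in> conn r `` {h}" by simp
    fix y z assume "y \<in> conn r `` {h}"
    then have "y \<notin> real_half_edges D" using that by blast
    then show "(y, z) \<in> r \<union> r\<inverse> \<longleftrightarrow> (y, z) \<in> curve_rel D s \<union> (curve_rel D s)\<inverse>"
      unfolding r_sym curve_rel_sym by (rule agree[symmetric])
  qed
  show ?thesis
  proof (intro equalityI subsetI)
    fix C assume "C \<in> {C \<in> state_curves D s. C \<inter> real_half_edges D = {}}"
    then show "C \<in> {C \<in> link_components D. C \<inter> real_half_edges D = {}}"
      using * unfolding link state_curves_eq classes_image by blast
  next
    fix C assume "C \<in> {C \<in> link_components D. C \<inter> real_half_edges D = {}}"
    then show "C \<in> {C \<in> state_curves D s. C \<inter> real_half_edges D = {}}"
      using ** unfolding link state_curves_eq classes_image by blast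
  qed
qed

lemma num_curves_constant:
  "num_curves D (constant_state D x) =
     card {C \<in> state_curves D (constant_state D x). C \<inter> real_half_edges D \<noteq> {}}
       + num_components_without_real_crossing D"
proof -
  let ?S = "state_curves D (constant_state D x)"
  have "finite ?S" by (simp add: state_curves_eq finite_classes finite_half_edges)
  moreover have "?S = {C \<in> ?S. C \<inter> real_half_edges D \<noteq> {}} \<union> {C \<in> ?S. C \<inter> real_half_edges D = {}}"
    by blast
  ultimately have "card ?S = card {C \<in> ?S. C \<inter> real_half_edges D \<noteq> {}}
      + card {C \<in> ?S. C \<inter> real_half_edges D = {}}"
    by (metis (no_types, lifting) card_Un_disjoint finite_Un disjoint_iff mem_Collect_eq)
  then show ?thesis
    by (simp add: num_curves_def num_components_without_real_crossing_def virtual_curves)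
qed

section \<open>Counting the arcs\<close>

lemma card_real_half_edges: "card (real_half_edges D) = 4 * card (real_crossings D)"
  by (simp add: real_half_edges_def card_cartesian_product)

text \<open>Orient the curves of a state: every arc starts at an outgoing and ends at an incoming real
  half-edge.\<close>

lemma card_arcs: "card (arcs D) = 2 * card (real_crossings D)"
proof -
  interpret involutions "half_edges D" "glue D" "through D (constant_state D ASplice)"
    by (rule involutions_state)
  let ?H = "half_edges D" and ?R = "real_half_edges D" and ?t = "through D (constant_state D ASplice)"
  obtain I where I: "I \<subseteq> ?H" "alternating I" using alternating_exists by blast
  have g: "glue D h \<in> I \<longleftrightarrow> h \<notin> I" and t: "?t h \<in> I \<longleftrightarrow> h \<notin> I" if "h \<in> ?H" for h
    using I(2) that by (auto simp: alternating_def)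
  have t_real: "?t h \<in> ?R \<longleftrightarrow> h \<in> ?R" for h
    by (cases h) (auto simp: real_half_edges_def through_def)
  have arc_step: "(h, h') \<in> arc_rel D \<longleftrightarrow> h \<in> ?H \<and> (h' = glue D h \<or> h \<notin> ?R \<and> h' = ?t h)" for h h'
    by (rule arc_rel_iff)
  \<comment> \<open>Advances along an oriented arc from one incoming half-edge to the next, passing
    a virtual crossing; it stops at an incoming real half-edge.\<close>
  define next_rel where "next_rel = {(h, glue D (?t h)) | h. h \<in> I - ?R}"
  have inj: "h = h'" if "glue D (?t h) = glue D (?t h')" "h \<in> ?H" "h' \<in> ?H" for h h'
    using that by (metis g_invol t_invol t_mem)
  have sv: "single_valued next_rel" "single_valued (next_rel\<inverse>)"
    unfolding next_rel_def single_valued_def using I(1) inj by blast+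
  \<comment> \<open>Representing each edge by its incoming half-edge turns walks along an arc into
    chains of \<open>next_rel\<close>.\<close>
  have walk: "y \<in> ?H \<and> (x, if y \<in> I then y else glue D y) \<in> conn next_rel"
    if x: "x \<in> I" and "(x, y) \<in> conn (arc_rel D)" for x y
  proof -
    have arc_sym: "(z, y) \<in> arc_rel D" if "(y, z) \<in> arc_rel D" for y z
      using that t_real[of y] unfolding arc_step by auto
    have walk_step: "(x, if z \<in> I then z else glue D z) \<in> conn next_rel"
      if "(x, if y \<in> I then y else glue D y) \<in> conn next_rel" "(y, z) \<in> arc_rel D" for y z
    proof -
      from that(2) have y: "y \<in> ?H" and "z = glue D y \<or> y \<notin> ?R \<and> z = ?t y"
        unfolding arc_step by auto
      then consider "z = glue D y" | "y \<notin> ?R" "z = ?t y" "y \<in> I" | "y \<notin> ?R" "z = ?t y" "y \<notin> I"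
        by blast
      then show ?thesis
      proof cases
        case 1
        then show ?thesis using that(1) g[OF y] y by auto
      next
        case 2
        then have "(y, glue D z) \<in> next_rel" unfolding next_rel_def by blast
        moreover have "(x, y) \<in> conn next_rel" "z \<notin> I" using that(1) 2 t[OF y] by auto
        ultimately show ?thesis using conn_trans[OF _ conn_base, of x y next_rel "glue D z"] by simp
      next
        case 3
        then have "(z, glue D y) \<in> next_rel" using t[OF y] t_real[of y] t_invol[OF y]
          unfolding next_rel_def by (intro CollectI exI[of _ z]) auto
        then have "(glue D y, z) \<in> conn next_rel" by (rule conn_sym[OF conn_base])
        moreover have "(x, glue D y) \<in> conn next_rel" "z \<in> I" using that(1) 3 t[OF y] by auto
        ultimately show ?thesis using conn_trans[of x "glue D y" next_rel z] by simp
      qed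
    qed
    have "x \<in> ?H" using x I(1) by blast
    show ?thesis using that(2)
    proof (induction rule: conn_induct)
      case base
      then show ?case using x I(1) by auto
    next
      case (step y z)
      then show ?case using walk_step[of y z] arc_rel_subset by blast
    next
      case (backstep y z)
      then show ?case using walk_step[of y z] arc_sym[of z y] arc_rel_subset by blast
    qed
  qed
  have "inj_on (\<lambda>h. conn (arc_rel D) `` {h}) (?R \<inter> I)"
  proof (rule inj_onI)
    fix h h' assume h: "h \<in> ?R \<inter> I" "h' \<in> ?R \<inter> I"
      and "conn (arc_rel D) `` {h} = conn (arc_rel D) `` {h'}"
    then have "(h, h') \<in> conn next_rel"
      using walk[of h h'] by (simp add: conn_class_eq_iff)
    \<comment> \<open>One of \<open>h\<close> and \<open>h'\<close> would precede the other in the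
      chain, but real half-edges have no successor; so they coincide.\<close>
    from conn_linear[OF sv this] show "h = h'"
      using h Not_Domain_rtrancl[of h next_rel h'] Not_Domain_rtrancl[of h' next_rel h]
      unfolding next_rel_def by blast
  qed
  moreover have "(\<lambda>h. conn (arc_rel D) `` {h}) ` (?R \<inter> I) = arcs D"
  proof (intro equalityI subsetI)
    fix a assume "a \<in> (\<lambda>h. conn (arc_rel D) `` {h}) ` (?R \<inter> I)"
    then obtain h where "h \<in> ?R" "a = conn (arc_rel D) `` {h}" by blast
    then show "a \<in> arcs D"
      using real_half_edges_subset conn_refl[of h "arc_rel D"] unfolding arcs_eq classes_image by blast
  next
    fix a assume "a \<in> arcs D"
    then have a: "a \<in> classes ?H (arc_rel D)" and ne: "a \<inter> ?R \<noteq> {}" by (auto simp: arcs_eq)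
    have sub: "a \<subseteq> ?H" using classes_subset[OF a arc_rel_subset] .
    then have fin: "finite a" using finite_half_edges finite_subset by blast
    have closed: "h' \<in> a" if "h \<in> a" "(h, h') \<in> arc_rel D" for h h'
      using class_of_mem[OF a that(1)] conn_base[OF that(2)] by blast
    have closed_g: "glue D h \<in> a" if "h \<in> a" for h
      using that closed[OF that, of "glue D h"] sub unfolding arc_step by blast
    have closed_t: "?t h \<in> a - ?R" if "h \<in> a - ?R" for h
      using that closed[of h "?t h"] sub t_real[of h] unfolding arc_step by blast
    \<comment> \<open>Edges pair incoming with outgoing half-edges of the arc, and virtual crossings
      do the same for its virtual half-edges. Its real half-edges are thus balanced too; since there
      are some, one of them is incoming.\<close>
    have "card (a \<inter> I) = card (a - I)"
      by (rule card_Int_eq_card_Diff[of _ "glue D"]) (use sub closed_g g g_invol in \<open>blast+\<close>)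
    moreover have "card ((a - ?R) \<inter> I) = card ((a - ?R) - I)"
      by (rule card_Int_eq_card_Diff[of _ ?t]) (use sub closed_t t t_invol in \<open>blast+\<close>)
    moreover have "card (a \<inter> I) = card (a \<inter> ?R \<inter> I) + card ((a - ?R) \<inter> I)"
    proof -
      have "a \<inter> I \<inter> ?R = a \<inter> ?R \<inter> I" "a \<inter> I - ?R = (a - ?R) \<inter> I" by blast+
      then show ?thesis using card_Int_Diff[of "a \<inter> I" ?R] fin by simp
    qed
    moreover have "card (a - I) = card (a \<inter> ?R - I) + card ((a - ?R) - I)"
    proof -
      have "(a - I) \<inter> ?R = a \<inter> ?R - I" "a - I - ?R = (a - ?R) - I" by blast+
      then show ?thesis using card_Int_Diff[of "a - I" ?R] fin by simp
    qed
    moreover have "card (a \<inter> ?R) = card (a \<inter> ?R \<inter> I) + card (a \<inter> ?R - I)"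
      using card_Int_Diff[of "a \<inter> ?R" I] fin by simp
    moreover have "card (a \<inter> ?R) \<noteq> 0" using ne fin by simp
    ultimately have "card (a \<inter> ?R \<inter> I) \<noteq> 0" by linarith
    then obtain h where h: "h \<in> a" "h \<in> ?R \<inter> I" by (metis Int_iff card.empty ex_in_conv)
    then show "a \<in> (\<lambda>h. conn (arc_rel D) `` {h}) ` (?R \<inter> I)"
      using class_of_mem[OF a h(1)] by blast
  qed
  ultimately have "card (arcs D) = card (?R \<inter> I)" by (metis card_image)
  \<comment> \<open>Strands of the A-splice pair incoming with outgoing real half-edges, so exactly
    half of the \<open>4 n\<close> are incoming.\<close>
  moreover have "card (?R \<inter> I) = card (?R - I)"
    by (rule card_Int_eq_card_Diff[of _ ?t]) (use real_half_edges_subset t t_real t_invol in \<open>blast+\<close>)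
  moreover have "card ?R = card (?R \<inter> I) + card (?R - I)"
    using finite_subset[OF real_half_edges_subset finite_half_edges] by (rule card_Int_Diff)
  ultimately show ?thesis using card_real_half_edges by linarith
qed

text \<open>Disks and bands contribute \<open>n - 2 n\<close>. A component without real crossing
  counts once in each of the two states, which matches the 2 of its sphere.\<close>

lemma turaev_euler_char_eq:
  "turaev_euler_char D =
     int (num_curves D (state_A D)) + int (num_curves D (state_B D)) - int (card (real_crossings D))"
  by (simp add: turaev_euler_char_def card_arcs boundary_components_card num_curves_constant)

end

theorem theorem4p3:
  fixes D D' :: "'c virtual_diagram" and p :: 'c
  assumes "virtual_link_diagram D'"
    and "pseudo_adequate D'"
    and "p \<in> real_crossings D'"
    and "D = virtualize D' p"
    and "\<forall>q \<in> real_crossings D.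
           arc_ends_on q (\<Union> (curves_at D (state_A D) p)) \<longrightarrow> admissible D (state_A D) q"
    and "\<forall>q \<in> real_crossings D.
           arc_ends_on q (\<Union> (curves_at D (state_B D) p)) \<longrightarrow> admissible D (state_B D) q"
  shows "laurent_span (bracket D) =
           4 * int (card (real_crossings D)) + 2 * (turaev_euler_char D - 2)"
proof -
  have D': "link_diagram D'" by (rule link_diagram_virtual_link_diagram[OF assms(1)])
  interpret link_diagram D unfolding assms(4) by (rule link_diagram_virtualize[OF D'])
  \<comment> \<open>The virtualized \<open>p\<close> remains a crossing of \<open>D\<close>.\<close>
  have "crossings D \<noteq> {}"
    using assms(3) link_diagram.real_crossings[OF D'] by (auto simp: assms(4))
  moreover have "num_curves D (flip (constant_state D x) q) \<le> num_curves D (constant_state D x)"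
    if "q \<in> real_crossings D" for x q
    using v_pseudo_adequate_flip[OF D' assms(2,4) _ that, of x] assms(5,6) by (cases x) auto
  ultimately show ?thesis
    by (simp add: laurent_span_bracket turaev_euler_char_eq)
qed

end
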